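(* Let $N=\binom{n}{3n/4}$. There is a constant $\varepsilon_0>0$ such that any two-sided, non-adaptive relative-error testing algorithm for deciding whether a function $f:\{0,1\}^n\to\{0,1\}$ with $|f^{-1}(1)|=\Theta(N)$ is unate or has $\mathrm{reldist}(f,\mathsf{Unate})\ge\varepsilon_0$ must make $\tilde{\Omega}(\log N)$ queries.
   Context: $n$ is a multiple of 4. Relative-error testing model: the algorithm has access to the membership oracle $\mathrm{MQ}(f)$ (returns $f(x)$ on query $x$) and the sampling oracle $\mathrm{SAMP}(f)$ (each call returns an independent uniformly random element of $f^{-1}(1)$); the number of queries is the total number of calls to both oracles. A two-sided tester accepts with probability at least $2/3$ if $f$ is unate and rejects with probability at least $2/3$ if $\mathrm{reldist}(f,\mathsf{Unate})\ge\varepsilon_0$. Non-adaptive means that after receiving all its $\mathrm{SAMP}(f)$ results, the algorithm makes one parallel round of $\mathrm{MQ}(f)$ queries (depending on the samples but not on other $\mathrm{MQ}$ answers). $f$ is unate if for every $i$, $f$ is monotone non-decreasing or monotone non-increasing in variable $i$; $\mathsf{Unate}$ is the class of unate functions. $\mathrm{reldist}(f,g)=|f^{-1}(1)\triangle g^{-1}(1)|/|f^{-1}(1)|$, minimized over $g\in\mathsf{Unate}$ for $\mathrm{reldist}(f,\mathsf{Unate})$. $\tilde\Omega$ hides polylogarithmic factors. *)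

theory Defs
  imports "HOL-Probability.Probability_Mass_Function"
begin

text \<open>
  Points of \<open>{0,1}\<^sup>n\<close> are Boolean lists of length \<open>n\<close>, and a function \<open>f : {0,1}\<^sup>n \<rightarrow> {0,1}\<close>
  is a predicate on Boolean lists of which only the values on \<open>cube n\<close> are ever used.
\<close>

type_synonym point = "bool list"

definition cube :: "nat \<Rightarrow> point set" where
  "cube n = {x. length x = n}"

definition sat :: "nat \<Rightarrow> (point \<Rightarrow> bool) \<Rightarrow> point set" where
  "sat n f = {x \<in> cube n. f x}"

definition unate :: "nat \<Rightarrow> (point \<Rightarrow> bool) \<Rightarrow> bool" where
  "unate n f \<longleftrightarrow>
     (\<forall>i<n. (\<forall>x\<in>cube n. mono (\<lambda>b. f (x[i := b]))) \<or>
            (\<forall>x\<in>cube n. antimono (\<lambda>b. f (x[i := b]))))"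

definition reldist :: "nat \<Rightarrow> (point \<Rightarrow> bool) \<Rightarrow> (point \<Rightarrow> bool) \<Rightarrow> real" where
  "reldist n f g = real (card (sym_diff (sat n f) (sat n g))) / real (card (sat n f))"

text \<open>The infimum ranges over finitely many distinct nonnegative values, so it is attained.\<close>

definition reldist_unate :: "nat \<Rightarrow> (point \<Rightarrow> bool) \<Rightarrow> real" where
  "reldist_unate n f = (INF g\<in>{g. unate n g}. reldist n f g)"

text \<open>
  A deterministic non-adaptive algorithm first draws samples one after another (it may decide
  from the samples seen so far whether to draw another one) and then makes a single parallel round
  of membership queries: in \<open>Round xs d\<close>, the list \<open>xs\<close> is queried and \<open>d\<close> maps the list of answers
  to the verdict, \<open>True\<close> meaning ``accept''. Both may depend on all samples drawn, as \<open>Round\<close>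
  occurs below the \<open>Samp\<close> nodes. A randomized algorithm is a distribution over deterministic ones.
\<close>

datatype det_alg =
    Samp "point \<Rightarrow> det_alg"
  | Round "point list" "bool list \<Rightarrow> bool"

type_synonym alg = "det_alg pmf"

primrec run_det :: "nat \<Rightarrow> (point \<Rightarrow> bool) \<Rightarrow> det_alg \<Rightarrow> bool pmf" where
  "run_det n f (Samp k) = bind_pmf (pmf_of_set (sat n f)) (\<lambda>x. run_det n f (k x))"
| "run_det n f (Round xs d) = return_pmf (d (map f xs))"

definition run :: "nat \<Rightarrow> (point \<Rightarrow> bool) \<Rightarrow> alg \<Rightarrow> bool pmf" where
  "run n f A = bind_pmf A (run_det n f)"

text \<open>
  The algorithm queries only points of the cube and makes at most \<open>q\<close> oracle calls in total,
  samples and membership queries together, in the worst case.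
\<close>

primrec det_calls_le :: "nat \<Rightarrow> det_alg \<Rightarrow> nat \<Rightarrow> bool" where
  "det_calls_le n (Samp k) q \<longleftrightarrow> q > 0 \<and> (\<forall>x\<in>cube n. det_calls_le n (k x) (q - 1))"
| "det_calls_le n (Round xs d) q \<longleftrightarrow> set xs \<subseteq> cube n \<and> length xs \<le> q"

definition calls_le :: "nat \<Rightarrow> alg \<Rightarrow> nat \<Rightarrow> bool" where
  "calls_le n A q \<longleftrightarrow> (\<forall>D\<in>set_pmf A. det_calls_le n D q)"

text \<open>A two-sided tester that only has to be correct on the functions in the promise class \<open>F\<close>.\<close>

definition unate_tester :: "nat \<Rightarrow> (point \<Rightarrow> bool) set \<Rightarrow> real \<Rightarrow> alg \<Rightarrow> bool" where
  "unate_tester n F \<epsilon> A \<longleftrightarrow>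
     (\<forall>f\<in>F. (unate n f \<longrightarrow> pmf (run n f A) True \<ge> 2/3) \<and>
            (reldist_unate n f \<ge> \<epsilon> \<longrightarrow> pmf (run n f A) False \<ge> 2/3))"

end

(*
  The tester has to tell apart two random functions on n = 4m variables that are constant outside the
  two layers of weight 3m and 3m + 1. Write a point as x = (a, v) with a in {0,1}^(3m). Each block
  "first part = a" has its own hidden random mask C, and on the two layers the points with a_1 = 1,
  |a| even and |C & v| even are split into cells according to (a, C & v); every cell carries an
  independent random function, which with probability 1/2 is a dictator x_j (unate case) or an
  antidictator ~x_j (far case), and otherwise essentially a constant. All other points of the two layers take the
  value of the threshold function |x| > 3m. Flipping a bit of a or a masked bit of v changes one of
  the parities, so monotonicity can only fail inside a cell: the functions of the first kind are
  monotone, while those of the second kind have, with high probability, a constant density of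
  disjoint decreasing edges, and for every variable many increasing edges.

  Two points far apart in one block lie in different cells except with tiny probability over C,
  whatever the tester knows, since distinct samples almost always lie in distinct blocks. Points that
  share a cell therefore differ in O(log n) coordinates, and s of them distinguish a dictator from an
  antidictator only if the hidden variable is among their O(s log n) differing coordinates, i.e. with
  probability O(s log n / n). Hence Omega(n / log n) calls are needed.
*)
theory Submission
  imports Defs "HOL-Probability.Product_PMF" "HOL-Real_Asymp.Real_Asymp"
begin

section \<open>Expectations over finite product distributions\<close>

text \<open>The obstacle is the sampling oracle: its answers are distributed according to the hidden
  function and so condition both laws. Two facts tame this. The number of satisfying points is
  concentrated around a mean common to both laws, so a sample can be treated as a point drawn with
  weight \<open>val_prob\<close>, an explicit number that does not depend on the law. And
  \<open>val_prob\<close> is 0 or at least 3/16, so conditioning on one sample costs at most a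
  factor 16/3. The errors from concentration and from samples in a common block are exponentially
  small, because a block has only 2^m points while N is at least 4^m; they survive multiplication by
  (16/3)^q as long as q is at most a small multiple of m. In the far case the obstacle is that a
  unate function may decrease in some variables, where decreasing edges cost nothing. This is why
  the points with first bit 0 keep the threshold values: they supply increasing edges to punish such
  a choice. Closeness of one query round is a hybrid argument on two levels, over blocks and, for a
  fixed mask, over cells.\<close>

abbreviation E :: "'a pmf \<Rightarrow> ('a \<Rightarrow> real) \<Rightarrow> real" where
  "E \<equiv> measure_pmf.expectation"

lemma E_cong: "(\<And>x. x \<in> set_pmf p \<Longrightarrow> f x = g x) \<Longrightarrow> E p f = E p g"
  by (intro integral_cong_AE) (auto simp: AE_measure_pmf_iff)

lemma E_mono:
  assumes "finite (set_pmf p)" "\<And>x. x \<in> set_pmf p \<Longrightarrow> f x \<le> g x"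
  shows "E p f \<le> E p g"
  by (intro integral_mono_AE integrable_measure_pmf_finite assms) (auto simp: AE_measure_pmf_iff assms)

lemma E_nonneg: "(\<And>x. x \<in> set_pmf p \<Longrightarrow> 0 \<le> f x) \<Longrightarrow> 0 \<le> E p f"
  by (intro integral_nonneg_AE) (auto simp: AE_measure_pmf_iff)

lemma E_add: "finite (set_pmf p) \<Longrightarrow> E p (\<lambda>x. f x + g x) = E p f + E p g"
  by (intro Bochner_Integration.integral_add integrable_measure_pmf_finite)

lemma E_diff: "finite (set_pmf p) \<Longrightarrow> E p (\<lambda>x. f x - g x) = E p f - E p g"
  by (intro Bochner_Integration.integral_diff integrable_measure_pmf_finite)

lemma E_sum: "finite (set_pmf p) \<Longrightarrow> E p (\<lambda>x. \<Sum>i\<in>I. f i x) = (\<Sum>i\<in>I. E p (f i))"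
  by (intro Bochner_Integration.integral_sum integrable_measure_pmf_finite)

lemma E_abs_le:
  assumes "finite (set_pmf p)" "\<And>x. x \<in> set_pmf p \<Longrightarrow> \<bar>f x\<bar> \<le> g x"
  shows "\<bar>E p f\<bar> \<le> E p g"
  using E_mono[of p "\<lambda>x. \<bar>f x\<bar>" g, OF assms] integral_abs_bound[of p f] by linarith

lemma E_abs_diff_le:
  assumes "finite (set_pmf p)" "\<And>x. x \<in> set_pmf p \<Longrightarrow> \<bar>f x - g x\<bar> \<le> h x"
  shows "\<bar>E p f - E p g\<bar> \<le> E p h"
  using E_abs_le[of p "\<lambda>x. f x - g x" h] assms by (simp add: E_diff)

lemma E_le_const:
  assumes "finite (set_pmf p)" "\<And>x. x \<in> set_pmf p \<Longrightarrow> f x \<le> c"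
  shows "E p f \<le> c"
  using E_mono[of p f "\<lambda>_. c"] assms by simp

lemma E_bind:
  assumes "finite (set_pmf p)" "\<And>x. x \<in> set_pmf p \<Longrightarrow> finite (set_pmf (q x))"
  shows "E (bind_pmf p q) h = E p (\<lambda>x. E (q x) h)"
  using assms by (subst pmf_expectation_bind[of "set_pmf p"])
    (auto simp: integral_measure_pmf[of "set_pmf p"])

lemma E_swap:
  assumes "finite (set_pmf p)" "finite (set_pmf q)"
  shows "E p (\<lambda>x. E q (h x)) = E q (\<lambda>y. E p (\<lambda>x. h x y))"
  using assms by (simp add: integral_measure_pmf[of "set_pmf p"] integral_measure_pmf[of "set_pmf q"]
      sum_distrib_left sum.swap[of _ "set_pmf p"] mult.left_commute)

lemma finite_set_Pi_pmf:
  "finite A \<Longrightarrow> (\<And>a. a \<in> A \<Longrightarrow> finite (set_pmf (p a))) \<Longrightarrow> finite (set_pmf (Pi_pmf A d p))"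
  by (auto simp: set_Pi_pmf)

lemma E_Pi_insert:
  assumes "finite A" "a \<notin> A" "\<And>b. b \<in> insert a A \<Longrightarrow> finite (set_pmf (p b))"
  shows "E (Pi_pmf (insert a A) d p) h = E (p a) (\<lambda>y. E (Pi_pmf A d p) (\<lambda>r. h (r(a := y))))"
proof -
  have "Pi_pmf (insert a A) d p
      = bind_pmf (p a) (\<lambda>y. map_pmf (\<lambda>r. r(a := y)) (Pi_pmf A d p))"
    using assms by (simp add: Pi_pmf_insert' map_pmf_def)
  thus ?thesis
    using assms by (simp add: E_bind finite_set_Pi_pmf)
qed

lemma E_Pi_prod:
  assumes "finite A" "\<And>a. a \<in> A \<Longrightarrow> finite (set_pmf (p a))"
    "\<And>a y. a \<in> A \<Longrightarrow> y \<in> set_pmf (p a) \<Longrightarrow> 0 \<le> w a y"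
  shows "E (Pi_pmf A d p) (\<lambda>r. \<Prod>a\<in>A. w a (r a)) = (\<Prod>a\<in>A. E (p a) (w a))"
  using assms by (intro expectation_prod_Pi_pmf integrable_measure_pmf_finite) auto

lemma E_Pi_component:
  assumes "finite A" "a \<in> A"
  shows "E (Pi_pmf A d p) (\<lambda>r. h (r a)) = E (p a) h"
  using integral_map_pmf[of "\<lambda>f. f a" "Pi_pmf A d p" h] Pi_pmf_component[OF assms(1), of a d p] assms(2)
  by simp

text \<open>Hybrid argument: the factors are exchanged one at a time.\<close>

lemma hybrid:
  assumes "finite A"
    and "\<And>a. a \<in> A \<Longrightarrow> finite (set_pmf (\<mu> a))" "\<And>a. a \<in> A \<Longrightarrow> finite (set_pmf (\<nu> a))"
    and "\<And>a y. 0 \<le> w a y" "\<And>a. a \<in> A \<Longrightarrow> 0 \<le> \<delta> a"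
    and "\<And>a. a \<in> A \<Longrightarrow> E (\<mu> a) (w a) \<le> p a" "\<And>a. a \<in> A \<Longrightarrow> E (\<nu> a) (w a) \<le> p a"
    and "\<And>a r. a \<in> A \<Longrightarrow> \<bar>E (\<mu> a) (\<lambda>y. \<Phi> (r(a := y))) - E (\<nu> a) (\<lambda>y. \<Phi> (r(a := y)))\<bar>
            \<le> \<delta> a * (\<Prod>b\<in>A - {a}. w b (r b))"
  shows "\<bar>E (Pi_pmf A d \<mu>) \<Phi> - E (Pi_pmf A d \<nu>) \<Phi>\<bar> \<le> (\<Sum>a\<in>A. \<delta> a * (\<Prod>b\<in>A - {a}. p b))"
  using assms
proof (induction A arbitrary: \<Phi> \<delta> rule: finite_induct)
  case empty
  then show ?case by simp
next
  case (insert a A)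
  have fin: "finite (set_pmf (Pi_pmf A d \<mu>))" "finite (set_pmf (Pi_pmf A d \<nu>))"
    using insert by (auto intro!: finite_set_Pi_pmf)
  have p0: "0 \<le> p b" if "b \<in> insert a A" for b
    using order_trans[OF E_nonneg insert.prems(5)[OF that]] insert.prems(3) by blast
  have ne: "insert a A - {b} = insert a (A - {b})" if "b \<in> A" for b
    using that insert by auto
  have fn: "finite (set_pmf (\<mu> a))" "finite (set_pmf (\<nu> a))" using insert by auto
  have da: "insert a A - {a} = A" using insert.hyps by auto
  let ?X = "E (\<mu> a) (\<lambda>y. E (Pi_pmf A d \<mu>) (\<lambda>r. \<Phi> (r(a := y))))"
  let ?Y = "E (\<nu> a) (\<lambda>y. E (Pi_pmf A d \<mu>) (\<lambda>r. \<Phi> (r(a := y))))"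
  let ?Z = "E (\<nu> a) (\<lambda>y. E (Pi_pmf A d \<nu>) (\<lambda>r. \<Phi> (r(a := y))))"
  \<comment> \<open>Only coordinate \<open>a\<close> is exchanged here. The other coordinates stay
    distributed by \<open>\<mu>\<close>, where the expected product of their weights factors by
    independence.\<close>
  have "\<bar>?X - ?Y\<bar> \<le> E (Pi_pmf A d \<mu>) (\<lambda>r. \<delta> a * (\<Prod>b\<in>A. w b (r b)))"
    unfolding E_swap[OF fn(1) fin(1)] E_swap[OF fn(2) fin(1)]
    by (intro E_abs_diff_le fin insert.prems(7)[of a, unfolded da]) auto
  also have "\<dots> = \<delta> a * (\<Prod>b\<in>A. E (\<mu> b) (w b))"
    using insert by (simp add: E_Pi_prod)
  also have "\<dots> \<le> \<delta> a * (\<Prod>b\<in>A. p b)"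
    using insert.prems by (intro mult_left_mono prod_mono) (auto intro!: E_nonneg)
  finally have 1: "\<bar>?X - ?Y\<bar> \<le> \<delta> a * (\<Prod>b\<in>A. p b)" .
  \<comment> \<open>Fixing coordinate \<open>a\<close> at \<open>y\<close> multiplies each remaining
    error bound by \<open>w a y\<close>, so the induction hypothesis is used with
    \<open>\<delta> b * w a y\<close>; averaging over \<open>y\<close> afterwards gives the missing
    factor \<open>p a\<close>.\<close>
  have IH: "\<bar>E (Pi_pmf A d \<mu>) (\<lambda>r. \<Phi> (r(a := y))) - E (Pi_pmf A d \<nu>) (\<lambda>r. \<Phi> (r(a := y)))\<bar>
      \<le> (\<Sum>b\<in>A. (\<delta> b * w a y) * (\<Prod>c\<in>A - {b}. p c))" for y
  proof (rule insert.IH)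
    fix b r assume b: "b \<in> A"
    have nb: "a \<noteq> b" using b insert.hyps by auto
    have "\<bar>E (\<mu> b) (\<lambda>z. \<Phi> ((r(a := y))(b := z))) - E (\<nu> b) (\<lambda>z. \<Phi> ((r(a := y))(b := z)))\<bar>
       \<le> \<delta> b * (\<Prod>c\<in>insert a A - {b}. w c ((r(a := y)) c))"
      using b by (intro insert.prems(7)) simp
    also have "(\<Prod>c\<in>insert a A - {b}. w c ((r(a := y)) c)) = w a y * (\<Prod>c\<in>A - {b}. w c (r c))"
      using insert.hyps by (subst ne[OF b]) (auto intro!: arg_cong[where f = "\<lambda>u. _ * u"] prod.cong split: if_splits)
    finally show "\<bar>E (\<mu> b) (\<lambda>z. \<Phi> ((r(b := z))(a := y))) - E (\<nu> b) (\<lambda>z. \<Phi> ((r(b := z))(a := y)))\<bar>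
       \<le> \<delta> b * w a y * (\<Prod>c\<in>A - {b}. w c (r c))"
      by (simp only: fun_upd_twist[OF nb] mult.assoc)
  qed (use insert.prems(1-6) in auto)
  have "\<bar>?Y - ?Z\<bar> \<le> E (\<nu> a) (\<lambda>y. (\<Sum>b\<in>A. (\<delta> b * w a y) * (\<Prod>c\<in>A - {b}. p c)))"
    using fn IH by (intro E_abs_diff_le) auto
  also have "\<dots> = E (\<nu> a) (w a) * (\<Sum>b\<in>A. \<delta> b * (\<Prod>c\<in>A - {b}. p c))"
    using fn by (simp add: E_sum sum_distrib_left mult.assoc mult.left_commute)
  also have "\<dots> \<le> p a * (\<Sum>b\<in>A. \<delta> b * (\<Prod>c\<in>A - {b}. p c))"
    using insert.prems p0 by (intro mult_right_mono sum_nonneg mult_nonneg_nonneg prod_nonneg) auto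
  also have "\<dots> = (\<Sum>b\<in>A. \<delta> b * (\<Prod>c\<in>insert a A - {b}. p c))"
    using insert.hyps unfolding sum_distrib_left by (intro sum.cong) (auto simp: ne)
  finally have 2: "\<bar>?Y - ?Z\<bar> \<le> (\<Sum>b\<in>A. \<delta> b * (\<Prod>c\<in>insert a A - {b}. p c))" .
  have "E (Pi_pmf (insert a A) d \<mu>) \<Phi> = ?X" "E (Pi_pmf (insert a A) d \<nu>) \<Phi> = ?Z"
    using insert by (auto intro!: E_Pi_insert)
  thus ?case using 1 2 insert.hyps by (simp add: da)
qed

lemma E_Pi_indep:
  assumes "finite A" "\<And>a. a \<in> A \<Longrightarrow> finite (set_pmf (p a))" "a \<in> A" "b \<in> A" "a \<noteq> b"
  shows "E (Pi_pmf A d p) (\<lambda>r. u (r a) * v (r b)) = E (p a) u * E (p b) v"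
proof -
  obtain A' where A': "A = insert a A'" "a \<notin> A'" by (metis assms(3) mk_disjoint_insert)
  have "E (Pi_pmf A d p) (\<lambda>r. u (r a) * v (r b))
      = E (p a) (\<lambda>y. E (Pi_pmf A' d p) (\<lambda>r. u y * v (r b)))"
    unfolding A'(1) using assms A' by (subst E_Pi_insert) auto
  also have "\<dots> = E (p a) (\<lambda>y. u y * E (p b) v)"
    using assms A' E_Pi_component[of A' b d p v] by simp
  finally show ?thesis by simp
qed

text \<open>Expand the square: centred terms from different blocks are independent and contribute 0,
  and a pair from one block contributes at most 1.\<close>

lemma variance_block_sum:
  assumes "finite A" "\<And>a. a \<in> A \<Longrightarrow> finite (set_pmf (p a))" "finite S" "\<And>x. x \<in> S \<Longrightarrow> \<beta> x \<in> A"
    and "\<And>x y. 0 \<le> \<psi> x y" "\<And>x y. \<psi> x y \<le> (1::real)"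
  shows "E (Pi_pmf A d p) (\<lambda>r. ((\<Sum>x\<in>S. \<psi> x (r (\<beta> x))) - (\<Sum>x\<in>S. E (p (\<beta> x)) (\<psi> x)))\<^sup>2)
    \<le> real (card {(x, y) \<in> S \<times> S. \<beta> x = \<beta> y})"
proof -
  let ?\<phi> = "\<lambda>x y. \<psi> x y - E (p (\<beta> x)) (\<psi> x)"
  have fin: "finite (set_pmf (Pi_pmf A d p))" using assms by (intro finite_set_Pi_pmf) auto
  have e0: "0 \<le> E (p (\<beta> x)) (\<psi> x)" "E (p (\<beta> x)) (\<psi> x) \<le> 1" if "x \<in> S" for x
    using assms that by (auto intro!: E_nonneg E_le_const)
  have b: "\<bar>?\<phi> x y\<bar> \<le> 1" if "x \<in> S" for x y
    using e0[OF that] assms(5)[of x y] assms(6)[of x y] by linarith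
  have "E (Pi_pmf A d p) (\<lambda>r. ((\<Sum>x\<in>S. \<psi> x (r (\<beta> x))) - (\<Sum>x\<in>S. E (p (\<beta> x)) (\<psi> x)))\<^sup>2)
     = E (Pi_pmf A d p) (\<lambda>r. \<Sum>x\<in>S. \<Sum>y\<in>S. ?\<phi> x (r (\<beta> x)) * ?\<phi> y (r (\<beta> y)))"
    by (simp add: sum_subtractf[symmetric] power2_eq_square sum_product)
  also have "\<dots> = (\<Sum>x\<in>S. \<Sum>y\<in>S. E (Pi_pmf A d p) (\<lambda>r. ?\<phi> x (r (\<beta> x)) * ?\<phi> y (r (\<beta> y))))"
    using fin by (simp add: E_sum)
  also have "\<dots> \<le> (\<Sum>x\<in>S. \<Sum>y\<in>S. if \<beta> x = \<beta> y then 1 else 0)"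
  proof (intro sum_mono)
    fix x y assume xy: "x \<in> S" "y \<in> S"
    show "E (Pi_pmf A d p) (\<lambda>r. ?\<phi> x (r (\<beta> x)) * ?\<phi> y (r (\<beta> y))) \<le> (if \<beta> x = \<beta> y then 1 else 0)"
    proof (cases "\<beta> x = \<beta> y")
      case True
      have "?\<phi> x u * ?\<phi> y v \<le> 1" for u v
        using mult_mono[OF b[OF xy(1), of u] b[OF xy(2), of v]]
          abs_le_D1[of "?\<phi> x u * ?\<phi> y v" 1] by (simp add: abs_mult)
      then show ?thesis using True fin by (auto intro!: E_le_const)
    next
      case False
      have "E (p (\<beta> x)) (?\<phi> x) = 0" using assms xy by (simp add: E_diff)
      then show ?thesis
        using False assms xy E_Pi_indep[of A p "\<beta> x" "\<beta> y" d "?\<phi> x" "?\<phi> y"] by simp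
    qed
  qed
  also have "\<dots> = (\<Sum>z\<in>S \<times> S. if \<beta> (fst z) = \<beta> (snd z) then 1 else 0)"
    by (simp add: sum.cartesian_product split_beta)
  also have "\<dots> = real (card {(x, y) \<in> S \<times> S. \<beta> x = \<beta> y})"
    using assms(3) by (auto simp: sum.If_cases intro!: arg_cong[where f = card])
  finally show ?thesis .
qed

section \<open>The two random functions\<close>

definition wt :: "bool list \<Rightarrow> nat" where
  "wt x = count_list x True"

definition mask :: "bool list \<Rightarrow> bool list \<Rightarrow> bool list" where
  "mask C v = map2 (\<and>) C v"

text \<open>The parity makes every change of a single bit of \<open>a\<close> leave the gated
  region. The first bit keeps half of the cube free of randomness, which
  \<open>card_trivial_edges\<close> exploits.\<close>

definition gate :: "bool list \<Rightarrow> bool" where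
  "gate a \<longleftrightarrow> hd a \<and> even (wt a)"

text \<open>
  A cell function is a dictator (\<open>s = True\<close>, unate case) or an antidictator (\<open>s = False\<close>, far case)
  with probability 1/2, and otherwise a constant or, rarely, the indicator of the upper layer. These
  are weighted so that the probability of the value \<open>True\<close> at a point of weight \<open>3 * m\<close> or
  \<open>3 * m + 1\<close> is the same in both cases.
\<close>

definition cell :: "nat \<Rightarrow> bool \<Rightarrow> bool \<times> nat \<Rightarrow> point \<Rightarrow> bool" where
  "cell m s = (\<lambda>(t, j) x. if s then t \<and> x ! j
     else if t then \<not> x ! j else j < 2 * m \<or> (j < 2 * m + 2 \<and> wt x = 3 * m + 1))"

definition cell_pmf :: "nat \<Rightarrow> bool \<Rightarrow> (point \<Rightarrow> bool) pmf" where
  "cell_pmf m s = map_pmf (cell m s) (pmf_of_set (UNIV \<times> {..<4 * m}))"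

text \<open>The mask selects the cell, but the cell function is evaluated at the whole point
  \<open>a @ v\<close>. The hidden index thus ranges over all 4m coordinates, which makes the chance
  of the value True depend on the weight alone.\<close>

definition block_fun :: "nat \<Rightarrow> point \<Rightarrow> point \<Rightarrow> (point \<Rightarrow> point \<Rightarrow> bool) \<Rightarrow> point \<Rightarrow> bool" where
  "block_fun m a C G v \<longleftrightarrow>
     (if wt a + wt v < 3 * m then False
      else if wt a + wt v > 3 * m + 1 then True
      else if gate a \<and> even (wt (mask C v)) then G (mask C v) (a @ v)
      else wt a + wt v = 3 * m + 1)"

definition cells_pmf :: "nat \<Rightarrow> bool \<Rightarrow> (point \<Rightarrow> point \<Rightarrow> bool) pmf" where
  "cells_pmf m s = Pi_pmf (cube m) undefined (\<lambda>_. cell_pmf m s)"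

definition block_pmf :: "nat \<Rightarrow> bool \<Rightarrow> point \<Rightarrow> (point \<Rightarrow> bool) pmf" where
  "block_pmf m s a =
     bind_pmf (pmf_of_set (cube m)) (\<lambda>C. map_pmf (block_fun m a C) (cells_pmf m s))"

definition law :: "nat \<Rightarrow> bool \<Rightarrow> (point \<Rightarrow> point \<Rightarrow> bool) pmf" where
  "law m s = Pi_pmf (cube (3 * m)) undefined (block_pmf m s)"

definition glue :: "nat \<Rightarrow> (point \<Rightarrow> point \<Rightarrow> bool) \<Rightarrow> point \<Rightarrow> bool" where
  "glue m F x = F (take (3 * m) x) (drop (3 * m) x)"

section \<open>Weights, masks and the supports of the laws\<close>

lemma finite_cube [simp]: "finite (cube n)"
  using finite_lists_length_eq[of "UNIV :: bool set" n] by (simp add: cube_def)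

lemma card_cube [simp]: "card (cube n) = 2 ^ n"
  using card_lists_length_eq[of "UNIV :: bool set" n] by (simp add: cube_def)

lemma cube_ne [simp]: "cube n \<noteq> {}"
  using card_cube[of n] by (metis card.empty power_not_zero zero_neq_numeral)

lemma length_mask [simp]: "length (mask C v) = min (length C) (length v)"
  by (simp add: mask_def)

lemma nth_mask [simp]: "i < length C \<Longrightarrow> i < length v \<Longrightarrow> mask C v ! i \<longleftrightarrow> C ! i \<and> v ! i"
  by (simp add: mask_def)

lemma mask_cube [intro]: "C \<in> cube m \<Longrightarrow> v \<in> cube m \<Longrightarrow> mask C v \<in> cube m"
  by (simp add: cube_def)

lemma wt_append [simp]: "wt (x @ y) = wt x + wt y"
  by (simp add: wt_def)

lemma wt_Cons [simp]: "wt (b # y) = of_bool b + wt y"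
  by (simp add: wt_def)

lemma wt_Nil [simp]: "wt [] = 0"
  by (simp add: wt_def)

lemma wt_replicate [simp]: "wt (replicate k True) = k"
  by (induction k) auto

lemma wt_card: "wt x = card {i. i < length x \<and> x ! i}"
  unfolding wt_def count_list_eq_length_filter length_filter_conv_card by (simp add: eq_commute)

lemma wt_le: "wt x \<le> length x"
  by (simp add: wt_def count_le_length)

lemma wt_update_True:
  "i < length x \<Longrightarrow> \<not> x ! i \<Longrightarrow> wt (x[i := True]) = Suc (wt x)"
proof (induction x arbitrary: i)
  case (Cons b x)
  then show ?case by (cases i) auto
qed simp

lemma wt_take_drop: "wt (take k x) + wt (drop k x) = wt x"
  by (metis wt_append append_take_drop_id)

lemma mask_update_outside:
  assumes "i < length C" "\<not> C ! i" "length v = length C"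
  shows "mask C (v[i := b]) = mask C v"
  using assms by (intro nth_equalityI) (auto simp: nth_list_update)

lemma wt_mask_update:
  assumes "i < length C" "C ! i" "length v = length C" "\<not> v ! i"
  shows "wt (mask C (v[i := True])) = Suc (wt (mask C v))"
proof -
  have "mask C (v[i := True]) = (mask C v)[i := True]"
    using assms by (intro nth_equalityI) (auto simp: nth_list_update)
  thus ?thesis using assms by (simp add: wt_update_True)
qed

lemma gate_nth: "0 < length a \<Longrightarrow> gate a \<longleftrightarrow> a ! 0 \<and> even (wt a)"
  by (auto simp: gate_def hd_conv_nth)

lemma set_cell_pmf: "0 < m \<Longrightarrow> set_pmf (cell_pmf m s) = cell m s ` (UNIV \<times> {..<4 * m})"
  by (auto simp: cell_pmf_def set_pmf_of_set lessThan_empty_iff)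

lemma finite_cell_pmf [simp]: "0 < m \<Longrightarrow> finite (set_pmf (cell_pmf m s))"
  by (simp add: set_cell_pmf)

lemma finite_cells_pmf [simp]: "0 < m \<Longrightarrow> finite (set_pmf (cells_pmf m s))"
  unfolding cells_pmf_def by (intro finite_set_Pi_pmf) auto

lemma set_block_pmf:
  "set_pmf (block_pmf m s a) = (\<Union>C\<in>cube m. block_fun m a C ` set_pmf (cells_pmf m s))"
  by (auto simp: block_pmf_def set_pmf_of_set)

lemma finite_block_pmf [simp]: "0 < m \<Longrightarrow> finite (set_pmf (block_pmf m s a))"
  by (simp add: set_block_pmf)

lemma finite_law [simp]: "0 < m \<Longrightarrow> finite (set_pmf (law m s))"
  unfolding law_def by (intro finite_set_Pi_pmf) auto

lemma law_blockE:
  assumes "F \<in> set_pmf (law m s)" "a \<in> cube (3 * m)" "0 < m"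
  obtains C G where "C \<in> cube m" "F a = block_fun m a C G"
    "\<forall>\<kappa>\<in>cube m. \<exists>t j. j < 4 * m \<and> G \<kappa> = cell m s (t, j)"
proof -
  have "F a \<in> set_pmf (block_pmf m s a)"
    using assms by (auto simp: law_def set_Pi_pmf PiE_dflt_def)
  then obtain C G where CG: "C \<in> cube m" "F a = block_fun m a C G" "G \<in> set_pmf (cells_pmf m s)"
    by (auto simp: set_block_pmf)
  moreover have "\<exists>t j. j < 4 * m \<and> G \<kappa> = cell m s (t, j)" if "\<kappa> \<in> cube m" for \<kappa>
  proof -
    have "G \<kappa> \<in> set_pmf (cell_pmf m s)"
      using that CG(3) by (auto simp: cells_pmf_def set_Pi_pmf PiE_dflt_def)
    thus ?thesis using assms by (auto simp: set_cell_pmf)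
  qed
  ultimately show ?thesis using that by blast
qed

lemma block_fun_low: "wt a + wt v < 3 * m \<Longrightarrow> \<not> block_fun m a C G v"
  and block_fun_high: "wt a + wt v > 3 * m + 1 \<Longrightarrow> block_fun m a C G v"
  by (auto simp: block_fun_def)

lemma glue_low:
  assumes "F \<in> set_pmf (law m s)" "x \<in> cube (4 * m)" "0 < m" "wt x < 3 * m"
  shows "\<not> glue m F x"
proof -
  have a: "take (3 * m) x \<in> cube (3 * m)" using assms by (auto simp: cube_def)
  obtain C G where "F (take (3 * m) x) = block_fun m (take (3 * m) x) C G"
    using law_blockE[OF assms(1) a assms(3)] by metis
  thus ?thesis using assms(4) by (auto simp: glue_def wt_take_drop intro!: block_fun_low)
qed

lemma glue_high:
  assumes "F \<in> set_pmf (law m s)" "x \<in> cube (4 * m)" "0 < m" "wt x > 3 * m + 1"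
  shows "glue m F x"
proof -
  have a: "take (3 * m) x \<in> cube (3 * m)" using assms by (auto simp: cube_def)
  obtain C G where "F (take (3 * m) x) = block_fun m (take (3 * m) x) C G"
    using law_blockE[OF assms(1) a assms(3)] by metis
  thus ?thesis using assms(4) by (auto simp: glue_def wt_take_drop intro!: block_fun_high)
qed

lemma glue_no_gate:
  assumes "F \<in> set_pmf (law m s)" "x \<in> cube (4 * m)" "0 < m" "\<not> gate (take (3 * m) x)"
  shows "glue m F x \<longleftrightarrow> wt x \<ge> 3 * m + 1"
proof -
  have a: "take (3 * m) x \<in> cube (3 * m)" using assms by (auto simp: cube_def)
  obtain C G where "F (take (3 * m) x) = block_fun m (take (3 * m) x) C G"
    using law_blockE[OF assms(1) a assms(3)] by metis
  thus ?thesis using assms(4) by (auto simp: glue_def wt_take_drop block_fun_def)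
qed

text \<open>
  An edge on which the function is not increasing joins the two random layers and stays in one cell:
  crossing a cell boundary flips one of the two parities, which forces the value \<open>True\<close> on the
  upper end.
\<close>

lemma decreasing_edge:
  assumes F: "F \<in> set_pmf (law m s)" and x: "x \<in> cube (4 * m)" and m: "0 < m"
    and i: "i < 4 * m" "\<not> x ! i" and fx: "glue m F x" and fy: "\<not> glue m F (x[i := True])"
  obtains a C G where "3 * m \<le> i" "wt x = 3 * m" "C \<in> cube m" "a = take (3 * m) x"
    "\<not> C ! (i - 3 * m)" "F a = block_fun m a C G" "gate a"
    "\<exists>t j. j < 4 * m \<and> G (mask C (drop (3 * m) x)) = cell m s (t, j)"
    "G (mask C (drop (3 * m) x)) x" "\<not> G (mask C (drop (3 * m) x)) (x[i := True])"
proof -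
  define a where "a = take (3 * m) x"
  define v where "v = drop (3 * m) x"
  have av: "a \<in> cube (3 * m)" "v \<in> cube m" "x = a @ v" "wt x = wt a + wt v"
    using x by (auto simp: cube_def a_def v_def wt_take_drop)
  have lx: "length x = 4 * m" using x by (simp add: cube_def)
  have y: "x[i := True] \<in> cube (4 * m)" using x by (simp add: cube_def)
  have wy: "wt (x[i := True]) = Suc (wt x)" using i lx by (simp add: wt_update_True)
  have w: "wt x = 3 * m"
    using glue_low[OF F x m] glue_high[OF F y m] fx fy wy by force
  obtain C G where CG: "C \<in> cube m" "F a = block_fun m a C G"
    "\<forall>\<kappa>\<in>cube m. \<exists>t j. j < 4 * m \<and> G \<kappa> = cell m s (t, j)"
    by (rule law_blockE[OF F av(1) m])
  have fa: "block_fun m a C G v" using fx CG(2) by (simp add: glue_def a_def v_def)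
  have g: "gate a" "even (wt (mask C v))" "G (mask C v) x"
    using fa w av by (auto simp: block_fun_def split: if_splits)
  have ga: "\<not> gate (take (3 * m) (x[i := True]))" if "i < 3 * m"
  proof -
    have "take (3 * m) (x[i := True]) = a[i := True]" by (simp add: a_def take_update_swap)
    moreover have "wt (a[i := True]) = Suc (wt a)"
      using that i lx by (intro wt_update_True) (auto simp: a_def)
    ultimately show ?thesis using g by (auto simp: gate_def)
  qed
  have i3: "3 * m \<le> i"
    using ga glue_no_gate[OF F y m] fy wy w by force
  have ty: "take (3 * m) (x[i := True]) = a" "drop (3 * m) (x[i := True]) = v[i - 3 * m := True]"
    using i3 by (auto simp: a_def v_def drop_update_swap)
  have vi: "\<not> v ! (i - 3 * m)" "i - 3 * m < m" using i i3 lx by (auto simp: v_def)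
  have xy: "a @ v[i - 3 * m := True] = x[i := True]"
    using ty by (metis append_take_drop_id)
  have wv: "wt (v[i - 3 * m := True]) = Suc (wt v)"
    using vi av by (intro wt_update_True) (auto simp: cube_def)
  have fb: "\<not> block_fun m a C G (v[i - 3 * m := True])"
    using fy CG(2) ty by (simp add: glue_def)
  have ev: "even (wt (mask C (v[i - 3 * m := True])))"
    and gy: "\<not> G (mask C (v[i - 3 * m := True])) (x[i := True])"
    using fb wv w av xy g(1) by (auto simp: block_fun_def split: if_splits)
  have Ci: "\<not> C ! (i - 3 * m)"
    using ev wt_mask_update[of "i - 3 * m" C v] vi g(2) av CG(1) by (auto simp: cube_def)
  have "mask C (v[i - 3 * m := True]) = mask C v"
    using Ci vi av CG(1) by (intro mask_update_outside) (auto simp: cube_def)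
  hence 1: "\<not> G (mask C v) (x[i := True])" using gy by simp
  have 2: "\<exists>t j. j < 4 * m \<and> G (mask C v) = cell m s (t, j)"
    using av CG(1) by (intro CG(3)[rule_format] mask_cube)
  show ?thesis
    by (rule that[OF i3 w CG(1) a_def Ci CG(2) g(1)]) (use 1 2 g v_def in auto)
qed

lemma mono_bool_iff: "mono (g :: bool \<Rightarrow> bool) \<longleftrightarrow> (g False \<longrightarrow> g True)"
  unfolding mono_def all_bool_eq by simp

lemma antimono_bool_iff: "antimono (g :: bool \<Rightarrow> bool) \<longleftrightarrow> (g True \<longrightarrow> g False)"
  unfolding monotone_on_def Ball_def all_bool_eq by auto

text \<open>A decreasing edge would lie inside one cell, whose function is constantly False or a
  dictator and therefore increasing.\<close>

lemma law_True_unate: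
  assumes "F \<in> set_pmf (law m True)" "0 < m"
  shows "unate (4 * m) (glue m F)"
  unfolding unate_def mono_bool_iff
proof (intro allI impI disjI1 ballI, rule ccontr)
  fix i x assume *: "i < 4 * m" "x \<in> cube (4 * m)"
    "glue m F (x[i := False])" "\<not> glue m F (x[i := True])"
  let ?x = "x[i := False]"
  have x: "?x \<in> cube (4 * m)" "\<not> ?x ! i" "?x[i := True] = x[i := True]"
    using * by (auto simp: cube_def)
  have "\<exists>t j. cell m True (t, j) ?x \<and> \<not> cell m True (t, j) (x[i := True])"
    by (rule decreasing_edge[OF assms(1) x(1) assms(2) *(1) x(2) *(3)]) (simp add: x(3) *(4), metis x(3))
  thus False
    using * by (auto simp: cell_def nth_list_update cube_def split: if_splits)
qed

text \<open>Decreasing edges do not share an upper end, which makes them usable as a matching. On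
  such an edge the cell function must be the antidictator of the direction of the edge, all other
  far-case cell functions being increasing. Two edges with the same upper end lie in the same block
  and the same cell, hence have the same direction.\<close>

lemma decreasing_edge_unique:
  assumes F: "F \<in> set_pmf (law m False)" and m: "0 < m"
    and x: "x \<in> cube (4 * m)" "i < 4 * m" "\<not> x ! i" "glue m F x"
    and x': "x' \<in> cube (4 * m)" "i' < 4 * m" "\<not> x' ! i'" "glue m F x'"
    and y: "x[i := True] = x'[i' := True]" "\<not> glue m F (x[i := True])"
  shows "x = x'"
proof -
  obtain a C G where 0: "3 * m \<le> i" "wt x = 3 * m" "C \<in> cube m" "a = take (3 * m) x"
    "\<not> C ! (i - 3 * m)" "F a = block_fun m a C G" "gate a"
    "\<exists>t j. j < 4 * m \<and> G (mask C (drop (3 * m) x)) = cell m False (t, j)"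
    "G (mask C (drop (3 * m) x)) x" "\<not> G (mask C (drop (3 * m) x)) (x[i := True])"
    by (rule decreasing_edge[OF F x(1) m x(2,3,4) y(2)])
  then obtain t j where tj: "j < 4 * m" "G (mask C (drop (3 * m) x)) = cell m False (t, j)" by blast
  note 1 = 0(1,2,4) tj(1) 0(5,3,6) tj(2) 0(9,10)
  have tx: "take (3 * m) x = take (3 * m) (x[i := True])" using 1 by simp
  have y': "\<not> glue m F (x'[i' := True])" using y by simp
  have i': "3 * m \<le> i' \<and> wt x' = 3 * m"
    by (rule decreasing_edge[OF F x'(1) m x'(2,3,4) y']) simp
  have lx: "length x = 4 * m" "length x' = 4 * m" using x x' by (auto simp: cube_def)
  have tx': "take (3 * m) x' = a" using i' tx 1 y by (metis take_update_cancel)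
  have "even (wt (mask C (drop (3 * m) x')))" "G (mask C (drop (3 * m) x')) x'"
    using x'(4) i' 1 tx' append_take_drop_id[of "3 * m" x'] wt_take_drop[of "3 * m" x']
    by (auto simp: glue_def block_fun_def split: if_splits)
  have ij: "i = j"
  proof (rule ccontr)
    assume "i \<noteq> j"
    thus False using 1(2,8,9,10) by (auto simp: cell_def nth_list_update split: if_splits)
  qed
  \<comment> \<open>A masked bit i' would make the masked parities of \<open>x'\<close> and of the
    common upper end differ. But that upper end is reached from \<open>x\<close> along an unmasked
    bit, so its parity is even, just like the parity at \<open>x'\<close>.\<close>
  have "\<not> C ! (i' - 3 * m)"
  proof
    assume C: "C ! (i' - 3 * m)"
    have "wt (mask C ((drop (3 * m) x')[i' - 3 * m := True])) = Suc (wt (mask C (drop (3 * m) x')))"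
      using C 1(6) i' x' lx by (intro wt_mask_update) (auto simp: cube_def)
    moreover have "(drop (3 * m) x')[i' - 3 * m := True] = drop (3 * m) (x[i := True])"
      using i' y by (simp add: drop_update_swap)
    moreover have "drop (3 * m) (x[i := True]) = (drop (3 * m) x)[i - 3 * m := True]"
      using 1 by (simp add: drop_update_swap)
    moreover have "mask C ((drop (3 * m) x)[i - 3 * m := True]) = mask C (drop (3 * m) x)"
      using 1 lx x by (intro mask_update_outside) (auto simp: cube_def)
    ultimately have "odd (wt (mask C (drop (3 * m) x)))"
      using \<open>even (wt (mask C (drop (3 * m) x')))\<close> by simp
    moreover have "even (wt (mask C (drop (3 * m) x)))"
      using x(4) 1 append_take_drop_id[of "3 * m" x] wt_take_drop[of "3 * m" x]
      by (auto simp: glue_def block_fun_def split: if_splits)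
    ultimately show False by simp
  qed
  hence "mask C (drop (3 * m) x') = mask C (drop (3 * m) (x'[i' := True]))"
    using i' lx x' 1(6) by (simp add: drop_update_swap) (subst mask_update_outside, auto simp: cube_def)
  also have "\<dots> = mask C (drop (3 * m) (x[i := True]))" using y by simp
  also have "\<dots> = mask C (drop (3 * m) x)"
    using 1 lx x by (simp add: drop_update_swap) (subst mask_update_outside, auto simp: cube_def)
  finally have "G (mask C (drop (3 * m) x)) x'"
    using \<open>G (mask C (drop (3 * m) x')) x'\<close> by simp
  hence "i' = j"
    using 1(2,8,9,10) i' y by (cases "i' = j") (auto simp: cell_def split: if_splits)
  hence "i = i'" using ij by simp
  have "x ! k = x' ! k" if "k < 4 * m" for k
    using y(1) \<open>i = i'\<close> x(3) x'(3) that by (metis nth_list_update_neq)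
  thus ?thesis using lx by (intro nth_equalityI) auto
qed

section \<open>Cells and block marginals\<close>

lemma E_cell_pmf:
  assumes "0 < m"
  shows "E (cell_pmf m s) \<psi> = (\<Sum>j<4 * m. \<psi> (cell m s (True, j)) + \<psi> (cell m s (False, j))) / (8 * real m)"
proof -
  have "E (cell_pmf m s) \<psi> = (\<Sum>p\<in>UNIV \<times> {..<4 * m}. \<psi> (cell m s p)) / real (card (UNIV \<times> {..<4 * m} :: (bool \<times> nat) set))"
    unfolding cell_pmf_def using assms
    by (subst integral_map_pmf, subst integral_pmf_of_set) (auto simp: lessThan_empty_iff)
  also have "(\<Sum>p\<in>UNIV \<times> {..<4 * m}. \<psi> (cell m s p)) = (\<Sum>t\<in>UNIV. \<Sum>j<4 * m. \<psi> (cell m s (t, j)))"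
    by (simp add: sum.cartesian_product)
  also have "\<dots> = (\<Sum>j<4 * m. \<psi> (cell m s (True, j)) + \<psi> (cell m s (False, j)))"
    by (simp add: UNIV_bool sum.distrib)
  finally show ?thesis by (simp add: card_cartesian_product)
qed

lemma sum_coords:
  assumes "length x = n"
  shows "(\<Sum>j<n. if x ! j then u else w) = real (wt x) * u + (real n - real (wt x)) * (w :: real)"
proof -
  have "(\<Sum>j<n. if x ! j then u else w) = (\<Sum>j\<in>{j. j < n \<and> x ! j}. u) + (\<Sum>j\<in>{j. j < n \<and> \<not> x ! j}. w)"
    by (simp add: sum.If_cases Int_def lessThan_def Compl_eq)
  moreover have "card {j. j < n \<and> \<not> x ! j} = n - card {j. j < n \<and> x ! j}"
  proof -
    have "{j. j < n \<and> \<not> x ! j} = {..<n} - {j. j < n \<and> x ! j}" by auto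
    thus ?thesis by (simp add: card_Diff_subset subset_eq)
  qed
  ultimately show ?thesis
    using wt_le[of x] assms by (simp add: wt_card of_nat_diff)
qed

text \<open>Among the 8m equally likely choices, the dictators give True exactly \<open>wt x\<close>
  times. The antidictators give 4m - \<open>wt x\<close>, and the remaining functions add 2m on
  layer 3m and 2m + 2 on layer 3m + 1; both totals equal \<open>wt x\<close>.\<close>

lemma E_cell_pmf_value:
  assumes "0 < m" "x \<in> cube (4 * m)" "wt x = 3 * m \<or> wt x = 3 * m + 1"
  shows "E (cell_pmf m s) (\<lambda>c. of_bool (c x)) = real (wt x) / (8 * real m)"
proof (cases s)
  case True
  then show ?thesis
    using assms sum_coords[of x "4 * m" 1 0]
    by (simp add: E_cell_pmf cell_def cube_def of_bool_def)
next
  case False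
  have lx: "length x = 4 * m" using assms by (simp add: cube_def)
  have "(\<Sum>j<4 * m. of_bool (j < 2 * m \<or> j < 2 * m + 2 \<and> wt x = 3 * m + 1)) =
      real (card {j. j < 4 * m \<and> (j < 2 * m \<or> j < 2 * m + 2 \<and> wt x = 3 * m + 1)})"
    by (simp add: sum.If_cases of_bool_def Int_def)
  also have "{j. j < 4 * m \<and> (j < 2 * m \<or> j < 2 * m + 2 \<and> wt x = 3 * m + 1)}
      = {..<2 * m + (if wt x = 3 * m + 1 then 2 else 0)}"
    using assms(1) by auto
  finally have 1: "(\<Sum>j<4 * m. of_bool (j < 2 * m \<or> j < 2 * m + 2 \<and> wt x = 3 * m + 1))
     = 2 * real m + (if wt x = 3 * m + 1 then 2 else 0)" by simp
  have "(\<Sum>j<4 * m. of_bool (\<not> x ! j)) = (\<Sum>j<4 * m. if x ! j then 0 else 1 :: real)"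
    by (intro sum.cong) auto
  hence 2: "(\<Sum>j<4 * m. of_bool (\<not> x ! j)) = 4 * real m - real (wt x)"
    using sum_coords[OF lx, of 0 1] by simp
  have "(\<Sum>j<4 * m. of_bool (\<not> x ! j) + of_bool (j < 2 * m \<or> j < 2 * m + 2 \<and> wt x = 3 * m + 1))
     = real (wt x)"
    unfolding sum.distrib 1 2 using assms(3) by auto
  then show ?thesis
    using False assms(1) by (simp add: E_cell_pmf cell_def)
qed

text \<open>An index j outside \<open>D\<close> makes a dictator or antidictator look constant on
  \<open>Z\<close>, so a test of the values on \<open>Z\<close> sees only a mixture of the constants
  True and False, with scores \<open>u\<close> and \<open>w\<close>. The frequencies of the two
  constants nearly agree in both cases. The errors are d for each of the two dictator sums, 2 for
  the upper-layer indicators and 2 for the frequencies, in total 2d + 4 out of 8m.\<close>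

lemma cell_close:
  assumes m: "0 < m" and Z: "Z \<subseteq> cube (4 * m)" "z0 \<in> Z" "wt z0 = 3 * m \<or> wt z0 = 3 * m + 1"
    and D: "finite D" "card D \<le> d" "\<And>z j. z \<in> Z \<Longrightarrow> j < 4 * m \<Longrightarrow> j \<notin> D \<Longrightarrow> z ! j = z0 ! j"
    and \<psi>: "\<And>c. 0 \<le> \<psi> c" "\<And>c. \<psi> c \<le> 1" "\<And>c c'. (\<And>z. z \<in> Z \<Longrightarrow> c z = c' z) \<Longrightarrow> \<psi> c = \<psi> c'"
  shows "\<bar>E (cell_pmf m True) \<psi> - E (cell_pmf m False) \<psi>\<bar> \<le> (real d + 2) / (4 * real m)"
proof -
  define u where "u = \<psi> (\<lambda>_. True)"
  define w where "w = \<psi> (\<lambda>_. False)"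
  have l0: "length z0 = 4 * m" using Z by (auto simp: cube_def)
  have uw: "\<bar>u - w\<bar> \<le> 1" using \<psi>(1,2)[of "\<lambda>_. True"] \<psi>(1,2)[of "\<lambda>_. False"] by (simp add: u_def w_def)
  have diff: "\<bar>\<psi> c - \<psi> c'\<bar> \<le> 1" for c c' using \<psi>(1,2)[of c] \<psi>(1,2)[of c'] by linarith
  have cT: "\<psi> (cell m True (False, j)) = w" for j
    unfolding w_def by (intro \<psi>(3)) (simp add: cell_def)
  have sum_le: "\<bar>(\<Sum>j<4 * m. \<psi> (f j)) - (\<Sum>j<4 * m. \<psi> (g j))\<bar> \<le> real (card X)"
    if "finite X" "\<And>j. j < 4 * m \<Longrightarrow> j \<notin> X \<Longrightarrow> \<psi> (f j) = \<psi> (g j)" for f g X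
  proof -
    have "\<bar>(\<Sum>j<4 * m. \<psi> (f j)) - (\<Sum>j<4 * m. \<psi> (g j))\<bar> \<le> (\<Sum>j<4 * m. \<bar>\<psi> (f j) - \<psi> (g j)\<bar>)"
      unfolding sum_subtractf[symmetric] by (rule sum_abs)
    also have "\<dots> \<le> (\<Sum>j<4 * m. if j \<in> X then 1 else 0)"
      using that diff by (intro sum_mono) auto
    also have "\<dots> = real (card ({..<4 * m} \<inter> X))"
      by (simp add: sum.If_cases)
    also have "\<dots> \<le> real (card X)" using that by (simp add: card_mono)
    finally show ?thesis .
  qed
  have "\<bar>(\<Sum>j<4 * m. \<psi> (cell m True (True, j))) - (\<Sum>j<4 * m. \<psi> (\<lambda>_. z0 ! j))\<bar> \<le> real (card D)"
    using D by (intro sum_le) (auto intro!: \<psi>(3) simp: cell_def)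
  moreover have "(\<Sum>j<4 * m. \<psi> (\<lambda>_. z0 ! j)) = (\<Sum>j<4 * m. if z0 ! j then u else w)"
    by (intro sum.cong) (auto simp: u_def w_def)
  ultimately have 1: "\<bar>(\<Sum>j<4 * m. \<psi> (cell m True (True, j)))
      - (real (wt z0) * u + (4 * real m - real (wt z0)) * w)\<bar> \<le> real d"
    using D sum_coords[OF l0, of u w] by simp
  have "\<bar>(\<Sum>j<4 * m. \<psi> (cell m False (True, j))) - (\<Sum>j<4 * m. \<psi> (\<lambda>_. \<not> z0 ! j))\<bar> \<le> real (card D)"
    using D by (intro sum_le) (auto intro!: \<psi>(3) simp: cell_def)
  moreover have "(\<Sum>j<4 * m. \<psi> (\<lambda>_. \<not> z0 ! j)) = (\<Sum>j<4 * m. if z0 ! j then w else u)"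
    by (intro sum.cong) (auto simp: u_def w_def)
  ultimately have 2: "\<bar>(\<Sum>j<4 * m. \<psi> (cell m False (True, j)))
      - (real (wt z0) * w + (4 * real m - real (wt z0)) * u)\<bar> \<le> real d"
    using D sum_coords[OF l0, of w u] by simp
  have "\<bar>(\<Sum>j<4 * m. \<psi> (cell m False (False, j))) - (\<Sum>j<4 * m. \<psi> (\<lambda>_. j < 2 * m))\<bar>
      \<le> real (card {2 * m, 2 * m + 1})"
    by (intro sum_le) (auto intro!: \<psi>(3) simp: cell_def)
  \<comment> \<open>The value at \<open>z0\<close> is now inverted, so \<open>u\<close> and
    \<open>w\<close> exchange places compared with the dictator case.\<close>
  moreover have "(\<Sum>j<4 * m. \<psi> (\<lambda>_. j < 2 * m)) = (\<Sum>j<4 * m. if j < 2 * m then u else w)"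
    by (intro sum.cong) (auto simp: u_def w_def)
  moreover have "{..<4 * m} \<inter> {j. j < 2 * m} = {..<2 * m}" "{..<4 * m} \<inter> - {j. j < 2 * m} = {2 * m..<4 * m}"
    by auto
  ultimately have 3: "\<bar>(\<Sum>j<4 * m. \<psi> (cell m False (False, j))) - (2 * real m * u + 2 * real m * w)\<bar> \<le> 2"
    by (simp add: sum.If_cases)
  let ?T = "(\<Sum>j<4 * m. \<psi> (cell m True (True, j)) + \<psi> (cell m True (False, j)))"
  let ?F = "(\<Sum>j<4 * m. \<psi> (cell m False (True, j)) + \<psi> (cell m False (False, j)))"
  let ?r = "real (wt z0)"
  \<comment> \<open>The net surplus 2r - 6m of constants True in the unate case is 0 or 2, as r is
    3m or 3m + 1.\<close>
  have "\<bar>(2 * ?r - 6 * real m) * (u - w)\<bar> \<le> 2 * 1"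
    unfolding abs_mult using uw Z(3) by (intro mult_mono) auto
  moreover have "(2 * ?r - 6 * real m) * (u - w)
     = (?r * u + (4 * real m - ?r) * w) + 4 * real m * w - (?r * w + (4 * real m - ?r) * u)
       - (2 * real m * u + 2 * real m * w)" by (simp add: algebra_simps)
  moreover have "?T = (\<Sum>j<4 * m. \<psi> (cell m True (True, j))) + 4 * real m * w"
    by (simp add: sum.distrib cT)
  ultimately have "\<bar>?T - ?F\<bar> \<le> 2 * real d + 4"
    using 1 2 3 unfolding sum.distrib abs_le_iff by linarith
  moreover have "E (cell_pmf m True) \<psi> - E (cell_pmf m False) \<psi> = (?T - ?F) / (8 * real m)"
    using m by (simp add: E_cell_pmf diff_divide_distrib)
  moreover have "(2 * real d + 4) / (8 * real m) = (real d + 2) / (4 * real m)"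
    using m by (simp add: field_simps)
  ultimately show ?thesis
    using divide_right_mono[of "\<bar>?T - ?F\<bar>" "2 * real d + 4" "8 * real m"] by (simp add: abs_divide)
qed

section \<open>Counting masks\<close>

lemma E_cube: "E (pmf_of_set (cube m)) f = (\<Sum>C\<in>cube m. f C) / 2 ^ m"
  by (subst integral_pmf_of_set) auto

lemma prob_mask_clear:
  assumes "D \<subseteq> {..<m}"
  shows "E (pmf_of_set (cube m)) (\<lambda>C. of_bool (\<forall>i\<in>D. \<not> C ! i)) \<le> 1 / 2 ^ card D"
proof -
  let ?S = "{C \<in> cube m. \<forall>i\<in>D. \<not> C ! i}"
  have fD: "finite D" using assms finite_subset by blast
  have "card ?S \<le> card (Pow ({..<m} - D))"
  proof (rule card_inj_on_le)
    show "inj_on (\<lambda>C. {i. i < m \<and> C ! i}) ?S"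
      by (rule inj_onI) (auto simp: cube_def list_eq_iff_nth_eq set_eq_iff)
  qed (use assms in auto)
  also have "\<dots> = 2 ^ (m - card D)"
    using assms fD by (simp add: card_Pow card_Diff_subset)
  finally have "real (card ?S) \<le> 2 ^ (m - card D)" using of_nat_mono by fastforce
  also have "(2::real) ^ (m - card D) = 2 ^ m / 2 ^ card D"
    using card_mono[OF _ assms] by (simp add: power_diff)
  finally have "real (card ?S) \<le> 2 ^ m / 2 ^ card D" .
  moreover have "(\<Sum>C\<in>cube m. of_bool (\<forall>i\<in>D. \<not> C ! i)) = real (card ?S)"
    by (simp add: of_bool_def sum.If_cases Int_def)
  ultimately show ?thesis by (simp add: E_cube field_simps)
qed

lemma card_half:
  assumes "finite S" "inj_on \<phi> S" "\<And>x. x \<in> S \<Longrightarrow> \<phi> x \<in> S" "\<And>x. x \<in> S \<Longrightarrow> \<not> P x \<Longrightarrow> P (\<phi> x)"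
  shows "card S \<le> 2 * card {x \<in> S. P x}"
proof -
  have "card {x \<in> S. \<not> P x} \<le> card {x \<in> S. P x}"
    using assms by (intro card_inj_on_le[of \<phi>]) (auto simp: inj_on_def)
  moreover have "card S = card {x \<in> S. P x} + card {x \<in> S. \<not> P x}"
    using assms(1) by (subst card_Un_disjoint[symmetric]) (auto intro!: arg_cong[where f = card])
  ultimately show ?thesis by simp
qed

lemma wt_mask_flip:
  assumes "i < length C" "v ! i" "length v = length C"
  shows "odd (wt (mask C v)) \<Longrightarrow> even (wt (mask (C[i := \<not> C ! i]) v))"
proof -
  have "mask (C[i := \<not> C ! i]) v = (mask C v)[i := \<not> C ! i]"
    using assms by (intro nth_equalityI) (auto simp: nth_list_update)
  moreover have "wt ((mask C v)[i := True]) = Suc (wt (mask C v))" if "\<not> C ! i"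
    using that assms by (intro wt_update_True) auto
  moreover have "wt (mask C v) = Suc (wt ((mask C v)[i := False]))" if "C ! i"
  proof -
    have "(mask C v)[i := False, i := True] = mask C v"
      using that assms by (intro nth_equalityI) (auto simp: nth_list_update)
    thus ?thesis using wt_update_True[of i "(mask C v)[i := False]"] assms by simp
  qed
  ultimately show "odd (wt (mask C v)) \<Longrightarrow> even (wt (mask (C[i := \<not> C ! i]) v))"
    by (cases "C ! i") auto
qed

lemma inj_flip: "inj_on (\<lambda>C. C[i := \<not> C ! i]) (cube m)"
proof (cases "i < m")
  case True
  show ?thesis
  proof (rule inj_on_inverseI[where g = "\<lambda>C. C[i := \<not> C ! i]"])
    fix C assume "C \<in> cube m"
    thus "C[i := \<not> C ! i, i := \<not> C[i := \<not> C ! i] ! i] = C"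
      using True by (simp add: cube_def)
  qed
next
  case False
  then show ?thesis by (auto simp: inj_on_def cube_def list_update_beyond)
qed

text \<open>If \<open>v\<close> has a one, flipping the mask there maps odd masks injectively to
  even ones. If \<open>v\<close> has none, every mask is even, which is why this is an
  inequality.\<close>

lemma card_even_mask:
  assumes "finite S" "S \<subseteq> cube m" "v \<in> cube m" "\<And>C i. C \<in> S \<Longrightarrow> i < m \<Longrightarrow> v ! i \<Longrightarrow> C[i := \<not> C ! i] \<in> S"
  shows "card S \<le> 2 * card {C \<in> S. even (wt (mask C v))}"
proof (cases "\<exists>i<m. v ! i")
  case True
  then obtain i where i: "i < m" "v ! i" by blast
  show ?thesis
  proof (rule card_half)
    show "inj_on (\<lambda>C. C[i := \<not> C ! i]) S" using inj_flip assms(2) inj_on_subset by blast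
  qed (use assms i in \<open>auto simp: cube_def intro!: wt_mask_flip\<close>)
next
  case False
  have "{i. i < length (mask C v) \<and> mask C v ! i} = {}" if "C \<in> S" for C
    using that False assms by (auto simp: cube_def)
  hence "even (wt (mask C v))" if "C \<in> S" for C
    using that by (metis wt_card card.empty even_zero)
  hence "{C \<in> S. even (wt (mask C v))} = S" by auto
  thus ?thesis by simp
qed

definition even_prob :: "nat \<Rightarrow> point \<Rightarrow> real" where
  "even_prob m v = E (pmf_of_set (cube m)) (\<lambda>C. of_bool (even (wt (mask C v))))"

lemma even_prob_ge:
  assumes "v \<in> cube m"
  shows "even_prob m v \<ge> 1 / 2"
proof -
  have "card (cube m) \<le> 2 * card {C \<in> cube m. even (wt (mask C v))}"
    using assms by (intro card_even_mask finite_cube) (auto simp: cube_def)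
  hence "real (2 ^ m) \<le> real (2 * card {C \<in> cube m. even (wt (mask C v))})"
    unfolding card_cube of_nat_le_iff .
  moreover have "(\<Sum>C\<in>cube m. of_bool (even (wt (mask C v)))) = real (card {C \<in> cube m. even (wt (mask C v))})"
    by (simp add: of_bool_def sum.If_cases Int_def)
  ultimately show ?thesis by (simp add: even_prob_def E_cube field_simps)
qed

lemma even_prob_le: "even_prob m v \<le> 1"
  unfolding even_prob_def by (intro E_le_const) auto

text \<open>Half of the masks are clear at \<open>j\<close>. Since \<open>v ! j\<close> is False,
  the flips that repair the parity act on other bits, so at least half of these masks are even as
  well.\<close>

lemma even_clear_prob_ge:
  assumes "v \<in> cube m" "j < m" "\<not> v ! j"
  shows "E (pmf_of_set (cube m)) (\<lambda>C. of_bool (even (wt (mask C v)) \<and> \<not> C ! j)) \<ge> 1 / 4"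
proof -
  let ?S = "{C \<in> cube m. \<not> C ! j}"
  have "card (cube m) \<le> 2 * card ?S"
    using assms by (intro card_half[where \<phi> = "\<lambda>C. C[j := \<not> C ! j]"] inj_flip finite_cube) (auto simp: cube_def)
  moreover have "finite ?S" by simp
  hence "card ?S \<le> 2 * card {C \<in> ?S. even (wt (mask C v))}"
    by (rule card_even_mask[of _ m]) (use assms in \<open>auto simp: cube_def nth_list_update\<close>)
  ultimately have "2 ^ m \<le> 4 * card {C \<in> ?S. even (wt (mask C v))}" by simp
  hence "real (2 ^ m) \<le> real (4 * card {C \<in> ?S. even (wt (mask C v))})"
    unfolding of_nat_le_iff .
  moreover have "(\<Sum>C\<in>cube m. of_bool (even (wt (mask C v)) \<and> \<not> C ! j))
     = real (card {C \<in> ?S. even (wt (mask C v))})"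
    by (auto simp: of_bool_def sum.If_cases intro!: arg_cong[where f = card])
  ultimately show ?thesis by (simp add: E_cube field_simps)
qed

section \<open>Marginals of a block at a single point\<close>

lemma E_block_pmf:
  assumes "0 < m"
  shows "E (block_pmf m s a) \<psi>
     = E (pmf_of_set (cube m)) (\<lambda>C. E (cells_pmf m s) (\<lambda>G. \<psi> (block_fun m a C G)))"
  unfolding block_pmf_def using assms by (subst E_bind) (auto simp: set_pmf_of_set)

lemma E_cells_component:
  "\<kappa> \<in> cube m \<Longrightarrow> E (cells_pmf m s) (\<lambda>G. h (G \<kappa>)) = E (cell_pmf m s) h"
  unfolding cells_pmf_def by (subst E_Pi_component) auto

text \<open>The chance that \<open>x\<close> gets the value True. There is no parameter
  \<open>s\<close>: the value at a single point says nothing about which law is present, as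
  \<open>E_block_value\<close> shows.\<close>

definition val_prob :: "nat \<Rightarrow> point \<Rightarrow> real" where
  "val_prob m x =
     (if wt x < 3 * m then 0 else if wt x > 3 * m + 1 then 1
      else if gate (take (3 * m) x)
      then even_prob m (drop (3 * m) x) * (real (wt x) / (8 * real m))
         + (1 - even_prob m (drop (3 * m) x)) * of_bool (wt x = 3 * m + 1)
      else of_bool (wt x = 3 * m + 1))"

lemma E_block_value:
  assumes m: "0 < m" and x: "x \<in> cube (4 * m)"
  shows "E (block_pmf m s (take (3 * m) x)) (\<lambda>f. of_bool (f (drop (3 * m) x))) = val_prob m x"
proof -
  let ?a = "take (3 * m) x" and ?v = "drop (3 * m) x"
  have v: "?v \<in> cube m" using x by (simp add: cube_def)
  have *: "E (cells_pmf m s) (\<lambda>G. of_bool (block_fun m ?a C G ?v)) =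
     (if wt x < 3 * m then 0 else if wt x > 3 * m + 1 then 1
      else if gate ?a \<and> even (wt (mask C ?v)) then real (wt x) / (8 * real m)
      else of_bool (wt x = 3 * m + 1))" if "C \<in> cube m" for C
  proof -
    have "E (cells_pmf m s) (\<lambda>G. of_bool (G (mask C ?v) x)) = real (wt x) / (8 * real m)"
      if "wt x = 3 * m \<or> wt x = 3 * m + 1"
      using that \<open>C \<in> cube m\<close> v m x
      by (subst E_cells_component[where h = "\<lambda>c. of_bool (c x)"]) (auto intro!: E_cell_pmf_value)
    thus ?thesis by (auto simp: block_fun_def wt_take_drop)
  qed
  have "E (block_pmf m s ?a) (\<lambda>f. of_bool (f ?v)) = E (pmf_of_set (cube m)) (\<lambda>C.
     (if wt x < 3 * m then 0 else if wt x > 3 * m + 1 then 1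
      else if gate ?a \<and> even (wt (mask C ?v)) then real (wt x) / (8 * real m)
      else of_bool (wt x = 3 * m + 1)))"
    unfolding E_block_pmf[OF m] by (intro E_cong *) (simp add: set_pmf_of_set)
  also have "\<dots> = val_prob m x"
  proof (cases "gate ?a \<and> \<not> wt x < 3 * m \<and> \<not> wt x > 3 * m + 1")
    case True
    let ?r = "real (wt x) / (8 * real m)" and ?b = "of_bool (wt x = 3 * m + 1) :: real"
    have "E (pmf_of_set (cube m)) (\<lambda>C. if even (wt (mask C ?v)) then ?r else ?b)
      = E (pmf_of_set (cube m)) (\<lambda>C. of_bool (even (wt (mask C ?v))) * (?r - ?b) + ?b)"
      by (intro E_cong) auto
    also have "\<dots> = even_prob m ?v * (?r - ?b) + ?b"
      by (subst E_add) (auto simp: even_prob_def set_pmf_of_set)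
    finally show ?thesis using True by (simp add: val_prob_def algebra_simps)
  next
    case False
    then show ?thesis by (auto simp: val_prob_def)
  qed
  finally show ?thesis .
qed

text \<open>On a gated point of the two layers the parity is even with probability at least 1/2, and
  then the value is True with probability at least 3/8. The bound controls the price of conditioning
  on samples.\<close>

lemma val_prob_ge:
  assumes "0 < m" "x \<in> cube (4 * m)" "val_prob m x \<noteq> 0"
  shows "val_prob m x \<ge> 3 / 16"
proof -
  let ?q = "even_prob m (drop (3 * m) x)"
  have q: "?q \<ge> 1 / 2" "?q \<le> 1"
    using assms even_prob_ge[of "drop (3 * m) x" m] even_prob_le by (auto simp: cube_def)
  have 1: "3 / 8 * ?q \<le> ?q * (real (wt x) / (8 * real m))" if "wt x = 3 * m \<or> wt x = 3 * m + 1"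
  proof -
    have "3 / 8 \<le> real (wt x) / (8 * real m)" using that assms(1) by (auto simp: field_simps)
    from mult_left_mono[OF this, of ?q] q show ?thesis by (simp add: mult.commute)
  qed
  have "3 / 16 \<le> ?q * (real (wt x) / (8 * real m)) + (1 - ?q) * of_bool (wt x = 3 * m + 1)"
    if "wt x = 3 * m \<or> wt x = 3 * m + 1"
  proof -
    have "0 \<le> (1 - ?q) * of_bool (wt x = 3 * m + 1)" using q by simp
    thus ?thesis using 1[OF that] q by linarith
  qed
  thus ?thesis using assms(3) by (auto simp: val_prob_def split: if_splits)
qed

lemma val_prob_01: "0 < m \<Longrightarrow> x \<in> cube (4 * m) \<Longrightarrow> 0 \<le> val_prob m x \<and> val_prob m x \<le> 1"
  by (subst (1 2) E_block_value[of m x True, symmetric]) (auto intro!: E_nonneg E_le_const)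

section \<open>Indistinguishability of one round of queries\<close>

text \<open>Call a mask bad if it puts two queries that differ in more than L places into one cell.
  Such a pair forces more than L mask bits to be 0, so a union bound over pairs gives the first
  term. For any other mask the cells are exchanged one by one with \<open>hybrid\<close>; a cell
  with k queries spreads over at most kL coordinates, so \<open>cell_close\<close> applies.\<close>

lemma block_close:
  assumes m: "0 < m" and a: "a \<in> cube (3 * m)" and V: "V \<subseteq> cube m" "card V \<le> s"
    and \<psi>: "\<And>f. 0 \<le> \<psi> f" "\<And>f. \<psi> f \<le> 1" "\<And>f f'. (\<And>v. v \<in> V \<Longrightarrow> f v = f' v) \<Longrightarrow> \<psi> f = \<psi> f'"
  shows "\<bar>E (block_pmf m True a) \<psi> - E (block_pmf m False a) \<psi>\<bar>
     \<le> (real s)\<^sup>2 / 2 ^ L + real s * (real L + 2) / (4 * real m)"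
proof -
  \<comment> \<open>Off the two layers a block function is deterministic. On them the weight
    condition of \<open>cell_close\<close> holds.\<close>
  define V' where "V' = {v \<in> V. wt a + wt v = 3 * m \<or> wt a + wt v = 3 * m + 1}"
  define dv where "dv v v' = {i. i < m \<and> v ! i \<noteq> v' ! i}" for v v' :: point
  define bad where "bad C \<longleftrightarrow> (\<exists>v\<in>V'. \<exists>v'\<in>V'. mask C v = mask C v' \<and> L < card (dv v v'))" for C
  have fV: "finite V" using V(1) finite_cube finite_subset by blast
  have fV': "finite V'" "V' \<subseteq> cube m" "card V' \<le> s"
    using fV V card_mono[OF fV, of V'] by (auto simp: V'_def)
  have \<psi>_diff: "\<bar>\<psi> f - \<psi> f'\<bar> \<le> 1" for f f'
    using \<psi>(1,2)[of f] \<psi>(1,2)[of f'] by linarith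
  have good: "\<bar>E (cells_pmf m True) (\<lambda>G. \<psi> (block_fun m a C G)) - E (cells_pmf m False) (\<lambda>G. \<psi> (block_fun m a C G))\<bar>
     \<le> real s * (real L + 2) / (4 * real m)" if C: "C \<in> cube m" and nb: "\<not> bad C" for C
  proof -
    define K where "K \<kappa> = {v \<in> V'. mask C v = \<kappa>}" for \<kappa>
    have fK: "finite (K \<kappa>)" for \<kappa> using fV' by (simp add: K_def)
    have "\<bar>E (cells_pmf m True) (\<lambda>G. \<psi> (block_fun m a C G)) - E (cells_pmf m False) (\<lambda>G. \<psi> (block_fun m a C G))\<bar>
      \<le> (\<Sum>\<kappa>\<in>cube m. real (card (K \<kappa>)) * (real L + 2) / (4 * real m) * (\<Prod>b\<in>cube m - {\<kappa>}. 1))"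
      unfolding cells_pmf_def
    proof (rule hybrid[where w = "\<lambda>_ _. 1"])
      fix \<kappa> :: point and r :: "point \<Rightarrow> point \<Rightarrow> bool" assume \<kappa>: "\<kappa> \<in> cube m"
      let ?\<psi> = "\<lambda>c. \<psi> (block_fun m a C (r(\<kappa> := c)))"
      have dep: "?\<psi> c = ?\<psi> c'" if "\<And>v. v \<in> K \<kappa> \<Longrightarrow> c (a @ v) = c' (a @ v)" for c c'
      proof (rule \<psi>(3))
        fix v assume "v \<in> V"
        hence "wt a + wt v < 3 * m \<or> wt a + wt v > 3 * m + 1 \<or> v \<in> V'" by (auto simp: V'_def)
        thus "block_fun m a C (r(\<kappa> := c)) v = block_fun m a C (r(\<kappa> := c')) v"
          using that[of v] by (elim disjE) (auto simp: block_fun_def K_def)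
      qed
      show "\<bar>E (cell_pmf m True) ?\<psi> - E (cell_pmf m False) ?\<psi>\<bar>
          \<le> real (card (K \<kappa>)) * (real L + 2) / (4 * real m) * (\<Prod>b\<in>cube m - {\<kappa>}. 1)"
      proof (cases "K \<kappa> = {}")
        case True
        hence "?\<psi> c = ?\<psi> undefined" for c using dep[of c undefined] by simp
        hence "E (cell_pmf m s) ?\<psi> = E (cell_pmf m s) (\<lambda>_. ?\<psi> undefined)" for s
          by (intro E_cong)
        thus ?thesis using True by simp
      next
        case False
        then obtain v0 where v0: "v0 \<in> K \<kappa>" by blast
        \<comment> \<open>All points of the block share \<open>a\<close>, so they can differ only in
          coordinates from 3m on; the shift translates positions in \<open>v\<close> to positions in
          \<open>a @ v\<close>.\<close>
        define D where "D = (\<lambda>i. 3 * m + i) ` (\<Union>v\<in>K \<kappa>. dv v v0)"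
        have "card D \<le> card (\<Union>v\<in>K \<kappa>. dv v v0)"
          unfolding D_def using fK by (intro card_image_le) (auto simp: dv_def)
        also have "\<dots> \<le> (\<Sum>v\<in>K \<kappa>. card (dv v v0))" using fK by (intro card_UN_le)
        also have "\<dots> \<le> (\<Sum>v\<in>K \<kappa>. L)"
          using nb v0 by (intro sum_mono) (force simp: bad_def K_def)
        finally have cD: "card D \<le> card (K \<kappa>) * L" by simp
        have "\<bar>E (cell_pmf m True) ?\<psi> - E (cell_pmf m False) ?\<psi>\<bar> \<le> (real (card (K \<kappa>) * L) + 2) / (4 * real m)"
        proof (rule cell_close[OF m, where Z = "(@) a ` K \<kappa>" and D = D])
          show "a @ v0 \<in> (@) a ` K \<kappa>" using v0 by simp
          show "wt (a @ v0) = 3 * m \<or> wt (a @ v0) = 3 * m + 1" using v0 by (auto simp: K_def V'_def)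
          show "(@) a ` K \<kappa> \<subseteq> cube (4 * m)" using a fV' by (auto simp: cube_def K_def)
          show "finite D" using fK by (auto simp: D_def dv_def)
          show "z ! j = (a @ v0) ! j" if zj: "z \<in> (@) a ` K \<kappa>" "j < 4 * m" "j \<notin> D" for z j
          proof -
            obtain v where v: "v \<in> K \<kappa>" "z = a @ v" using zj(1) by blast
            have la: "length a = 3 * m" using a by (simp add: cube_def)
            show ?thesis
            proof (cases "j < 3 * m")
              case True then show ?thesis using la v by (simp add: nth_append)
            next
              case False
              hence "j = 3 * m + (j - 3 * m)" "j - 3 * m < m" using zj by auto
              hence "v ! (j - 3 * m) = v0 ! (j - 3 * m)"
                using zj(3) v(1) unfolding D_def dv_def by blast
              then show ?thesis using la v False by (simp add: nth_append)
            qed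
          qed
          show "?\<psi> c = ?\<psi> c'" if "\<And>z. z \<in> (@) a ` K \<kappa> \<Longrightarrow> c z = c' z" for c c'
            using that by (intro dep) simp
        qed (use cD \<psi>(1,2) in auto)
        \<comment> \<open>As the cell contains a query, the extra 2 can be charged to each of its
          queries. The bound becomes linear in the number of queries and can be summed over the
          cells.\<close>
        also have "\<dots> \<le> real (card (K \<kappa>)) * (real L + 2) / (4 * real m)"
        proof (rule divide_right_mono)
          have "1 \<le> card (K \<kappa>)" using False fK by (simp add: Suc_leI card_gt_0_iff)
          thus "real (card (K \<kappa>) * L) + 2 \<le> real (card (K \<kappa>)) * (real L + 2)"
            by (simp add: algebra_simps)
        qed simp
        finally show ?thesis by simp
      qed
    qed (use m in auto)
    also have "\<dots> = (\<Sum>\<kappa>\<in>cube m. real (card (K \<kappa>))) * (real L + 2) / (4 * real m)"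
      by (simp add: sum_distrib_right sum_divide_distrib)
    also have "(\<Sum>\<kappa>\<in>cube m. real (card (K \<kappa>))) = real (card V')"
    proof -
      have "(\<Sum>\<kappa>\<in>cube m. \<Sum>v\<in>{v \<in> V'. mask C v = \<kappa>}. 1) = (\<Sum>v\<in>V'. 1::real)"
        using fV' C by (intro sum.group) auto
      thus ?thesis by (simp add: K_def)
    qed
    also have "real (card V') * (real L + 2) / (4 * real m) \<le> real s * (real L + 2) / (4 * real m)"
      using fV' by (intro divide_right_mono mult_right_mono) auto
    finally show ?thesis .
  qed
  have "\<bar>E (block_pmf m True a) \<psi> - E (block_pmf m False a) \<psi>\<bar>
     \<le> E (pmf_of_set (cube m)) (\<lambda>C. of_bool (bad C) + real s * (real L + 2) / (4 * real m))"
    unfolding E_block_pmf[OF m]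
  proof (intro E_abs_diff_le)
    fix C assume "C \<in> set_pmf (pmf_of_set (cube m))"
    hence C: "C \<in> cube m" by (simp add: set_pmf_of_set)
    have "\<bar>E (cells_pmf m True) (\<lambda>G. \<psi> (block_fun m a C G)) - E (cells_pmf m False) (\<lambda>G. \<psi> (block_fun m a C G))\<bar> \<le> 1"
    proof -
      have "0 \<le> E (cells_pmf m s) (\<lambda>G. \<psi> (block_fun m a C G))" "E (cells_pmf m s) (\<lambda>G. \<psi> (block_fun m a C G)) \<le> 1" for s
        using \<psi>(1,2) m by (auto intro!: E_nonneg E_le_const)
      from this[of True] this[of False] show ?thesis by linarith
    qed
    thus "\<bar>E (cells_pmf m True) (\<lambda>G. \<psi> (block_fun m a C G)) - E (cells_pmf m False) (\<lambda>G. \<psi> (block_fun m a C G))\<bar>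
       \<le> of_bool (bad C) + real s * (real L + 2) / (4 * real m)"
      using good[OF C] by (cases "bad C") (auto intro: order_trans)
  qed (simp add: set_pmf_of_set)
  also have "\<dots> = E (pmf_of_set (cube m)) (\<lambda>C. of_bool (bad C)) + real s * (real L + 2) / (4 * real m)"
    by (subst E_add) (auto simp: set_pmf_of_set)
  also have "E (pmf_of_set (cube m)) (\<lambda>C. of_bool (bad C))
      \<le> E (pmf_of_set (cube m)) (\<lambda>C. \<Sum>v\<in>V'. \<Sum>v'\<in>V'. of_bool (mask C v = mask C v' \<and> L < card (dv v v')))"
  proof (intro E_mono)
    fix C
    show "of_bool (bad C) \<le> (\<Sum>v\<in>V'. \<Sum>v'\<in>V'. of_bool (mask C v = mask C v' \<and> L < card (dv v v')) :: real)"
    proof (cases "bad C")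
      case True
      then obtain v v' where v: "v \<in> V'" "v' \<in> V'" "mask C v = mask C v' \<and> L < card (dv v v')"
        unfolding bad_def by blast
      have "1 \<le> (\<Sum>v'\<in>V'. of_bool (mask C v = mask C v' \<and> L < card (dv v v')) :: real)"
        using v fV' by (intro order_trans[OF _ member_le_sum[of v']]) auto
      also have "\<dots> \<le> (\<Sum>v\<in>V'. \<Sum>v'\<in>V'. of_bool (mask C v = mask C v' \<and> L < card (dv v v')))"
        using v fV' by (intro member_le_sum[of v V' "\<lambda>v. \<Sum>v'\<in>V'. of_bool (mask C v = mask C v' \<and> L < card (dv v v')) :: real"] sum_nonneg) auto
      finally show ?thesis using True by simp
    qed (auto intro!: sum_nonneg)
  qed (simp add: set_pmf_of_set)
  also have "\<dots> = (\<Sum>v\<in>V'. \<Sum>v'\<in>V'. E (pmf_of_set (cube m)) (\<lambda>C. of_bool (mask C v = mask C v' \<and> L < card (dv v v'))))"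
    by (simp add: E_sum set_pmf_of_set)
  also have "\<dots> \<le> (\<Sum>v\<in>V'. \<Sum>v'\<in>V'. 1 / 2 ^ L)"
  proof (intro sum_mono)
    fix v v' assume v: "v \<in> V'" "v' \<in> V'"
    have lv: "length v = m" "length v' = m" using v fV' by (auto simp: cube_def)
    show "E (pmf_of_set (cube m)) (\<lambda>C. of_bool (mask C v = mask C v' \<and> L < card (dv v v'))) \<le> 1 / 2 ^ L"
    proof (cases "L < card (dv v v')")
      case True
      have "E (pmf_of_set (cube m)) (\<lambda>C. of_bool (mask C v = mask C v' \<and> L < card (dv v v')))
         \<le> E (pmf_of_set (cube m)) (\<lambda>C. of_bool (\<forall>i\<in>dv v v'. \<not> C ! i))"
      proof (intro E_mono)
        fix C assume "C \<in> set_pmf (pmf_of_set (cube m))"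
        hence "C \<in> cube m" by (simp add: set_pmf_of_set)
        hence lC: "length C = m" by (simp add: cube_def)
        have "\<not> C ! i" if "mask C v = mask C v'" "i \<in> dv v v'" for i
        proof -
          have "mask C v ! i = mask C v' ! i" by (simp add: that(1))
          thus ?thesis using that(2) lC lv by (auto simp: dv_def)
        qed
        thus "of_bool (mask C v = mask C v' \<and> L < card (dv v v')) \<le> (of_bool (\<forall>i\<in>dv v v'. \<not> C ! i) :: real)"
          by auto
      qed (simp add: set_pmf_of_set)
      also have "\<dots> \<le> 1 / 2 ^ card (dv v v')" by (intro prob_mask_clear) (auto simp: dv_def)
      also have "\<dots> \<le> 1 / 2 ^ L" using True by (intro divide_left_mono power_increasing) auto
      finally show ?thesis .
    qed simp
  qed
  also have "\<dots> = (real (card V'))\<^sup>2 / 2 ^ L" by (simp add: power2_eq_square)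
  also have "\<dots> \<le> (real s)\<^sup>2 / 2 ^ L" using fV' by (intro divide_right_mono power_mono) auto
  finally show ?thesis by simp
qed

text \<open>
  One round of membership queries \<open>Z\<close>, conditioned on the samples \<open>X\<close> having value \<open>True\<close>. Since
  distinct samples lie in distinct blocks, only the blocks met by \<open>Z\<close> contribute.
\<close>

lemma round_close:
  assumes m: "0 < m" and X: "finite X" "X \<subseteq> cube (4 * m)" "inj_on (take (3 * m)) X"
    and Z: "Z \<subseteq> cube (4 * m)" "card Z \<le> q"
    and \<psi>: "\<And>f. 0 \<le> \<psi> f" "\<And>f. \<psi> f \<le> 1" "\<And>f f'. (\<And>z. z \<in> Z \<Longrightarrow> f z = f' z) \<Longrightarrow> \<psi> f = \<psi> f'"
    and pos: "\<And>x. x \<in> X \<Longrightarrow> val_prob m x \<noteq> 0"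
  defines "W \<equiv> \<lambda>s. E (law m s) (\<lambda>F. (\<Prod>x\<in>X. of_bool (glue m F x)) * \<psi> (glue m F))"
  shows "\<bar>W True - W False\<bar> \<le> (\<Prod>x\<in>X. val_prob m x) * (16 / 3 *
      (4 * (real q)\<^sup>2 / 2 ^ L + 2 * real q * (real L + 2) / (4 * real m)))"
proof -
  define A where "A = cube (3 * m)"
  define Xa where "Xa a = {x \<in> X. take (3 * m) x = a}" for a
  define Za where "Za a = {x \<in> Z. take (3 * m) x = a}" for a
  \<comment> \<open>The conditioning on the samples of block \<open>a\<close>. Its mean is
    \<open>p a\<close> under both laws, as at most one sample lies in the block.\<close>
  define w where "w a f = (\<Prod>x\<in>Xa a. of_bool (f (drop (3 * m) x) :: bool) :: real)" for a f
  define p where "p a = (\<Prod>x\<in>Xa a. val_prob m x)" for a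
  define \<epsilon> where "\<epsilon> n = (real n)\<^sup>2 / 2 ^ L + real n * (real L + 2) / (4 * real m)" for n
  \<comment> \<open>The added 1 is the possible sample in the block. Without a query in the block
    only \<open>w a\<close> depends on it, and its means under the two laws coincide.\<close>
  define \<delta> where "\<delta> a = (if Za a = {} then 0 else \<epsilon> (card (Za a) + 1))" for a
  let ?\<Phi> = "\<lambda>F. (\<Prod>x\<in>X. of_bool (glue m F x)) * \<psi> (glue m F) :: real"
  have fA: "finite A" by (simp add: A_def)
  have fZ: "finite Z" using Z(1) finite_cube finite_subset by blast
  have tA: "take (3 * m) x \<in> A" if "x \<in> X \<or> x \<in> Z" for x
    using that X Z by (auto simp: A_def cube_def)
  have \<epsilon>0: "0 \<le> \<epsilon> n" for n by (simp add: \<epsilon>_def)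
  have Xa: "Xa a = {} \<or> (\<exists>x\<in>X. take (3 * m) x = a \<and> Xa a = {x})" for a
  proof (cases "Xa a = {}")
    case False
    then obtain x where "x \<in> X" "take (3 * m) x = a" by (auto simp: Xa_def)
    moreover have "Xa a = {x}"
      using X(3) calculation by (auto simp: Xa_def inj_on_def)
    ultimately show ?thesis by blast
  qed simp
  have Ew: "E (block_pmf m s a) (w a) = p a" if "a \<in> A" for s a
    using Xa[of a] E_block_value[OF m, of _ s] X(2) by (auto simp: w_def[abs_def] p_def)
  have w01: "0 \<le> w a f" "w a f \<le> 1" for a f
    by (auto simp: w_def intro!: prod_nonneg prod_le_1)
  have p_ge: "3 / 16 \<le> p a" if "a \<in> A" for a
    using Xa[of a] val_prob_ge[OF m] X(2) pos by (auto simp: p_def)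
  have pX: "(\<Prod>a\<in>A. p a) = (\<Prod>x\<in>X. val_prob m x)"
    unfolding p_def Xa_def using X(1) fA tA by (intro prod.group) auto
  have prodX: "(\<Prod>x\<in>X. of_bool (glue m F x) :: real) = (\<Prod>a\<in>A. w a (F a))" for F
  proof -
    have "(\<Prod>a\<in>A. w a (F a)) = (\<Prod>a\<in>A. \<Prod>x\<in>{x \<in> X. take (3 * m) x = a}. of_bool (glue m F x))"
      unfolding w_def Xa_def by (intro prod.cong refl) (auto simp: glue_def)
    also have "\<dots> = (\<Prod>x\<in>X. of_bool (glue m F x))"
      using X(1) fA tA by (intro prod.group) auto
    finally show ?thesis ..
  qed
  have "\<bar>W True - W False\<bar> \<le> (\<Sum>a\<in>A. \<delta> a * (\<Prod>b\<in>A - {a}. p b))"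
    unfolding W_def law_def A_def[symmetric]
  proof (rule hybrid[where w = w])
    fix a r assume a: "a \<in> A"
    define R where "R = (\<Prod>b\<in>A - {a}. w b (r b))"
    have R: "0 \<le> R" by (auto simp: R_def intro!: prod_nonneg w01)
    have eq: "?\<Phi> (r(a := y)) = R * (w a y * \<psi> (glue m (r(a := y))))" for y
    proof -
      have "(\<Prod>b\<in>A. w b ((r(a := y)) b)) = w a y * (\<Prod>b\<in>A - {a}. w b ((r(a := y)) b))"
        using a fA by (subst prod.remove[of A a]) auto
      also have "(\<Prod>b\<in>A - {a}. w b ((r(a := y)) b)) = R"
        unfolding R_def by (intro prod.cong) auto
      finally show ?thesis unfolding prodX by simp
    qed
    let ?\<psi> = "\<lambda>y. w a y * \<psi> (glue m (r(a := y)))"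
    have "\<bar>E (block_pmf m True a) ?\<psi> - E (block_pmf m False a) ?\<psi>\<bar> \<le> \<delta> a"
    proof (cases "Za a = {}")
      case True
      have "\<psi> (glue m (r(a := y))) = \<psi> (glue m (r(a := undefined)))" for y
        using True by (intro \<psi>(3)) (auto simp: glue_def Za_def)
      hence "E (block_pmf m s a) ?\<psi> = E (block_pmf m s a) (\<lambda>y. w a y * \<psi> (glue m (r(a := undefined))))" for s
        by (intro E_cong) simp
      thus ?thesis using Ew[OF a] True by (simp add: \<delta>_def)
    next
      case False
      have "\<bar>E (block_pmf m True a) ?\<psi> - E (block_pmf m False a) ?\<psi>\<bar> \<le> \<epsilon> (card (Za a) + 1)"
        unfolding \<epsilon>_def
      proof (rule block_close[OF m, where V = "drop (3 * m) ` (Xa a \<union> Za a)"])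
        show "a \<in> cube (3 * m)" using a by (simp add: A_def)
        show "drop (3 * m) ` (Xa a \<union> Za a) \<subseteq> cube m"
          using X Z by (auto simp: Xa_def Za_def cube_def subset_iff)
        have "card (drop (3 * m) ` (Xa a \<union> Za a)) \<le> card (Xa a \<union> Za a)"
          using X fZ by (intro card_image_le) (auto simp: Xa_def Za_def)
        also have "\<dots> \<le> card (Xa a) + card (Za a)" by (rule card_Un_le)
        also have "card (Xa a) \<le> 1" using Xa[of a] by (elim disjE bexE conjE) simp_all
        finally show "card (drop (3 * m) ` (Xa a \<union> Za a)) \<le> card (Za a) + 1" by simp
        show "0 \<le> ?\<psi> y" for y using w01 \<psi>(1,2) by simp
        show "?\<psi> y \<le> 1" for y using w01 \<psi>(1,2) by (intro mult_le_one) auto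
        fix f f' :: "point \<Rightarrow> bool"
        assume ff: "\<And>v. v \<in> drop (3 * m) ` (Xa a \<union> Za a) \<Longrightarrow> f v = f' v"
        have "w a f = w a f'" unfolding w_def using ff by (intro prod.cong) auto
        moreover have "\<psi> (glue m (r(a := f))) = \<psi> (glue m (r(a := f')))"
          using ff by (intro \<psi>(3)) (auto simp: glue_def Za_def)
        ultimately show "?\<psi> f = ?\<psi> f'" by simp
      qed
      thus ?thesis using False by (simp add: \<delta>_def)
    qed
    from mult_left_mono[OF this R]
    show "\<bar>E (block_pmf m True a) (\<lambda>y. ?\<Phi> (r(a := y))) - E (block_pmf m False a) (\<lambda>y. ?\<Phi> (r(a := y)))\<bar>
       \<le> \<delta> a * (\<Prod>b\<in>A - {a}. w b (r b))"
      unfolding eq R_def[symmetric] using R by (simp add: abs_mult mult.commute flip: right_diff_distrib)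
  qed (use m fA w01 Ew in \<open>auto simp: \<delta>_def intro: \<epsilon>0\<close>)
  also have "\<dots> \<le> (\<Sum>a\<in>A. (\<Prod>x\<in>X. val_prob m x) * (16 / 3 * \<delta> a))"
  proof (intro sum_mono)
    fix a assume a: "a \<in> A"
    have d0: "0 \<le> \<delta> a" using \<epsilon>0 by (auto simp: \<delta>_def)
    have "0 \<le> p b" if "b \<in> A" for b using p_ge[OF that] by linarith
    hence P0: "0 \<le> (\<Prod>b\<in>A - {a}. p b)" by (intro prod_nonneg) auto
    have "(\<Prod>x\<in>X. val_prob m x) = p a * (\<Prod>b\<in>A - {a}. p b)"
      unfolding pX[symmetric] using a fA by (subst prod.remove[of A a]) auto
    \<comment> \<open>\<open>hybrid\<close> leaves out the factor of the exchanged block; putting it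
      back to complete the product over all samples costs 16/3.\<close>
    moreover have "1 \<le> 16 / 3 * p a" using p_ge[OF a] by simp
    hence "1 * (\<delta> a * (\<Prod>b\<in>A - {a}. p b)) \<le> 16 / 3 * p a * (\<delta> a * (\<Prod>b\<in>A - {a}. p b))"
      using d0 P0 by (intro mult_right_mono) auto
    ultimately show "\<delta> a * (\<Prod>b\<in>A - {a}. p b) \<le> (\<Prod>x\<in>X. val_prob m x) * (16 / 3 * \<delta> a)"
      by (simp add: algebra_simps)
  qed
  also have "\<dots> = (\<Prod>x\<in>X. val_prob m x) * (16 / 3 * (\<Sum>a\<in>A. \<delta> a))"
    by (simp add: sum_distrib_left)
  also have "\<dots> \<le> (\<Prod>x\<in>X. val_prob m x) * (16 / 3 *
      (4 * (real q)\<^sup>2 / 2 ^ L + 2 * real q * (real L + 2) / (4 * real m)))"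
  proof (intro mult_left_mono)
    have cZ: "(\<Sum>a\<in>A. real (card (Za a))) = real (card Z)"
    proof -
      have "(\<Sum>a\<in>A. \<Sum>x\<in>{x \<in> Z. take (3 * m) x = a}. 1) = (\<Sum>x\<in>Z. 1::real)"
        using fZ fA tA by (intro sum.group) auto
      thus ?thesis by (simp add: Za_def)
    qed
    \<comment> \<open>With k at least 1 queries in the block, (k + 1)^2 is at most 4k^2 and hence at
      most 4qk. This is linear in k, so the sum over all blocks is of order q^2.\<close>
    have "\<delta> a \<le> 4 * (real q * real (card (Za a))) / 2 ^ L + 2 * real (card (Za a)) * (real L + 2) / (4 * real m)" for a
    proof (cases "Za a = {}")
      case False
      have cq: "card (Za a) \<le> q" using Z fZ card_mono[of Z "Za a"] by (auto simp: Za_def)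
      have c1: "1 \<le> card (Za a)" using False fZ by (simp add: Suc_leI card_gt_0_iff Za_def)
      have c2: "real (card (Za a) + 1) \<le> 2 * real (card (Za a))" using c1 by simp
      have "(real (card (Za a) + 1))\<^sup>2 \<le> (2 * real (card (Za a)))\<^sup>2"
        using c2 by (intro power_mono) auto
      also have "\<dots> = 4 * (real (card (Za a)) * real (card (Za a)))" by (simp add: power2_eq_square)
      also have "\<dots> \<le> 4 * (real q * real (card (Za a)))"
        using cq by (intro mult_left_mono mult_right_mono) auto
      finally have "(real (card (Za a) + 1))\<^sup>2 \<le> 4 * (real q * real (card (Za a)))" .
      hence "(real (card (Za a) + 1))\<^sup>2 / 2 ^ L \<le> 4 * (real q * real (card (Za a))) / 2 ^ L"
        by (intro divide_right_mono) auto
      moreover have "real (card (Za a) + 1) * (real L + 2) / (4 * real m)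
          \<le> 2 * real (card (Za a)) * (real L + 2) / (4 * real m)"
        using c2 by (intro divide_right_mono mult_right_mono) auto
      ultimately show ?thesis using False unfolding \<delta>_def \<epsilon>_def by simp
    qed (simp add: \<delta>_def)
    hence "(\<Sum>a\<in>A. \<delta> a) \<le> (\<Sum>a\<in>A. 4 * (real q * real (card (Za a))) / 2 ^ L
        + 2 * real (card (Za a)) * (real L + 2) / (4 * real m))" by (intro sum_mono)
    also have "\<dots> = 4 * (real q * real (card Z)) / 2 ^ L + 2 * real (card Z) * (real L + 2) / (4 * real m)"
      by (simp add: sum.distrib cZ[symmetric] sum_distrib_left sum_distrib_right sum_divide_distrib)
    also have "\<dots> \<le> 4 * (real q * real q) / 2 ^ L + 2 * real q * (real L + 2) / (4 * real m)"
      using Z(2) by (intro add_mono divide_right_mono mult_right_mono mult_left_mono) auto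
    finally show "(\<Sum>a\<in>A. \<delta> a) \<le> 4 * (real q)\<^sup>2 / 2 ^ L + 2 * real q * (real L + 2) / (4 * real m)"
      by (simp add: power2_eq_square)
    show "0 \<le> (\<Prod>x\<in>X. val_prob m x)" using val_prob_01[OF m] X(2) by (intro prod_nonneg) auto
  qed auto
  finally show ?thesis .
qed

section \<open>Samples\<close>

definition upper :: "nat \<Rightarrow> point set" where
  "upper m = {x \<in> cube (4 * m). 3 * m \<le> wt x}"

text \<open>The expected number of satisfying points, common to both laws.\<close>

definition mean_sat :: "nat \<Rightarrow> real" where
  "mean_sat m = (\<Sum>x\<in>cube (4 * m). val_prob m x)"

lemma finite_upper [simp]: "finite (upper m)"
  by (simp add: upper_def)

lemma finite_sat [simp]: "finite (sat n f)"
  by (simp add: sat_def)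

text \<open>A point \<open>y\<close> in the block of \<open>x\<close> is determined by its last m
  bits, so at most \<open>card S * 2 ^ m\<close> pairs share a block.\<close>

lemma variance_law:
  assumes m: "0 < m" and S: "S \<subseteq> cube (4 * m)" and \<psi>: "\<And>x f. 0 \<le> \<psi> x f" "\<And>x f. \<psi> x f \<le> (1::real)"
  shows "E (law m s) (\<lambda>F. ((\<Sum>x\<in>S. \<psi> x (F (take (3 * m) x)))
     - (\<Sum>x\<in>S. E (block_pmf m s (take (3 * m) x)) (\<psi> x)))\<^sup>2) \<le> real (card S) * 2 ^ m"
proof -
  have fS: "finite S" using S finite_cube finite_subset by blast
  have "card {(x, y) \<in> S \<times> S. take (3 * m) x = take (3 * m) y} \<le> card (S \<times> cube m)"
  proof (rule card_inj_on_le[where f = "\<lambda>(x, y). (x, drop (3 * m) y)"])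
    show "inj_on (\<lambda>(x, y). (x, drop (3 * m) y)) {(x, y) \<in> S \<times> S. take (3 * m) x = take (3 * m) y}"
      by (auto simp: inj_on_def) (metis append_take_drop_id)
    show "(\<lambda>(x, y). (x, drop (3 * m) y)) ` {(x, y) \<in> S \<times> S. take (3 * m) x = take (3 * m) y} \<subseteq> S \<times> cube m"
      using S by (auto simp: cube_def)
  qed (use fS in simp)
  also have "\<dots> = card S * 2 ^ m" by (simp add: card_cartesian_product)
  finally have "real (card {(x, y) \<in> S \<times> S. take (3 * m) x = take (3 * m) y}) \<le> real (card S * 2 ^ m)"
    by (rule of_nat_mono)
  hence "real (card {(x, y) \<in> S \<times> S. take (3 * m) x = take (3 * m) y}) \<le> real (card S) * 2 ^ m"
    unfolding of_nat_mult of_nat_power of_nat_numeral .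
  moreover have "take (3 * m) x \<in> cube (3 * m)" if "x \<in> S" for x
    using that S by (auto simp: cube_def)
  ultimately show ?thesis
    unfolding law_def using fS m \<psi>
    by (intro order_trans[OF variance_block_sum]) auto
qed

lemma E_law_value:
  assumes "0 < m" "x \<in> cube (4 * m)"
  shows "E (law m s) (\<lambda>F. of_bool (glue m F x)) = val_prob m x"
proof -
  have "take (3 * m) x \<in> cube (3 * m)" using assms by (auto simp: cube_def)
  hence "E (law m s) (\<lambda>F. of_bool (F (take (3 * m) x) (drop (3 * m) x)))
     = E (block_pmf m s (take (3 * m) x)) (\<lambda>f. of_bool (f (drop (3 * m) x)))"
    unfolding law_def by (intro E_Pi_component[where h = "\<lambda>f. of_bool (f (drop (3 * m) x))"]) auto
  thus ?thesis using assms by (simp add: glue_def E_block_value)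
qed

lemma val_prob_upper: "val_prob m x \<noteq> 0 \<Longrightarrow> 3 * m \<le> wt x"
  by (auto simp: val_prob_def split: if_splits)

text \<open>Pointwise, 2 sqrt(v) |Y| is at most Y^2 + v; taking expectations gives the
  bound.\<close>

lemma E_abs_le_sqrt:
  assumes "finite (set_pmf p)" "E p (\<lambda>x. (Y x)\<^sup>2) \<le> v" "0 < v"
  shows "E p (\<lambda>x. \<bar>Y x\<bar>) \<le> sqrt v"
proof -
  have "E p (\<lambda>x. \<bar>Y x\<bar>) \<le> E p (\<lambda>x. (Y x)\<^sup>2 * (1 / (2 * sqrt v)) + sqrt v / 2)"
  proof (intro E_mono assms(1))
    fix x
    have "0 \<le> (\<bar>Y x\<bar> - sqrt v)\<^sup>2" by simp
    hence "2 * sqrt v * \<bar>Y x\<bar> \<le> (Y x)\<^sup>2 + (sqrt v)\<^sup>2"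
      unfolding power2_diff power2_abs by (simp only: mult_ac)
    thus "\<bar>Y x\<bar> \<le> (Y x)\<^sup>2 * (1 / (2 * sqrt v)) + sqrt v / 2"
      using assms(3) by (simp add: field_simps power2_eq_square)
  qed
  also have "\<dots> = E p (\<lambda>x. (Y x)\<^sup>2) * (1 / (2 * sqrt v)) + sqrt v / 2"
    using assms(1) by (subst E_add) auto
  also have "\<dots> \<le> v * (1 / (2 * sqrt v)) + sqrt v / 2"
    using assms by (intro add_mono mult_right_mono) auto
  also have "\<dots> = sqrt v"
    using assms(3) by (simp add: field_simps)
  finally show ?thesis .
qed

lemma sat_upper:
  assumes "F \<in> set_pmf (law m s)" "0 < m"
  shows "sat (4 * m) (glue m F) \<subseteq> upper m"
  using glue_low[OF assms(1) _ assms(2)] by (force simp: sat_def upper_def)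

lemma card_sat:
  assumes "F \<in> set_pmf (law m s)" "0 < m"
  shows "real (card (sat (4 * m) (glue m F))) = (\<Sum>x\<in>upper m. of_bool (glue m F x))"
proof -
  have "sat (4 * m) (glue m F) = upper m \<inter> {x. glue m F x}"
    using sat_upper[OF assms] by (auto simp: sat_def upper_def)
  thus ?thesis by (simp add: of_bool_def sum.If_cases)
qed

lemma mean_sat_upper: "mean_sat m = (\<Sum>x\<in>upper m. val_prob m x)"
  unfolding mean_sat_def using val_prob_upper
  by (intro sum.mono_neutral_right) (auto simp: upper_def)

text \<open>The deviation is tiny relative to the mean, which is of order N, because 2^m is at most
  N / 2^m.\<close>

lemma sat_concentrated:
  assumes m: "1 < m"
  shows "E (law m s) (\<lambda>F. \<bar>real (card (sat (4 * m) (glue m F))) - mean_sat m\<bar>)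
     \<le> sqrt (real (card (upper m)) * 2 ^ m)"
proof (rule E_abs_le_sqrt)
  show "finite (set_pmf (law m s))" using m by simp
  have "replicate (4 * m) True \<in> upper m"
    by (simp add: upper_def cube_def)
  hence "card (upper m) > 0" by (auto simp: card_gt_0_iff)
  thus "0 < real (card (upper m)) * 2 ^ m" by simp
  have "E (law m s) (\<lambda>F. (real (card (sat (4 * m) (glue m F))) - mean_sat m)\<^sup>2)
    = E (law m s) (\<lambda>F. ((\<Sum>x\<in>upper m. of_bool (F (take (3 * m) x) (drop (3 * m) x)))
     - (\<Sum>x\<in>upper m. E (block_pmf m s (take (3 * m) x)) (\<lambda>f. of_bool (f (drop (3 * m) x)))))\<^sup>2)"
    using m by (intro E_cong) (simp add: card_sat mean_sat_upper glue_def E_block_value upper_def)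
  also have "\<dots> \<le> real (card (upper m)) * 2 ^ m"
    using m by (intro variance_law) (auto simp: upper_def)
  finally show "E (law m s) (\<lambda>F. (real (card (sat (4 * m) (glue m F))) - mean_sat m)\<^sup>2)
     \<le> real (card (upper m)) * 2 ^ m" .
qed

lemma ones_sat:
  assumes "F \<in> set_pmf (law m s)" "1 < m"
  shows "replicate (4 * m) True \<in> sat (4 * m) (glue m F)"
  using assms glue_high[OF assms(1), of "replicate (4 * m) True"]
  by (simp add: sat_def cube_def)

lemma mean_sat_pos:
  assumes "1 < m"
  shows "0 < mean_sat m"
  unfolding mean_sat_def
proof (rule sum_pos2[of _ "replicate (4 * m) True"])
  show "replicate (4 * m) True \<in> cube (4 * m)" by (simp add: cube_def)
  show "0 < val_prob m (replicate (4 * m) True)" using assms by (simp add: val_prob_def)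
qed (use assms val_prob_01 in auto)

lemma run_Samp:
  assumes "sat n f \<noteq> {}"
  shows "pmf (run_det n f (Samp k)) True
     = (\<Sum>x\<in>cube n. of_bool (f x) * pmf (run_det n f (k x)) True) / real (card (sat n f))"
proof -
  have "(\<Sum>x\<in>sat n f. pmf (run_det n f (k x)) True)
     = (\<Sum>x\<in>cube n. of_bool (f x) * pmf (run_det n f (k x)) True)"
    by (intro sum.mono_neutral_cong_left) (auto simp: sat_def)
  thus ?thesis using assms by (simp add: pmf_bind integral_pmf_of_set)
qed

text \<open>\<open>X\<close> collects the samples drawn so far and r bounds the calls still to come.
  The acceptance probability is weighted by the event that all of \<open>X\<close> is satisfied
  rather than conditioned on it, so a sampling step becomes a sum over the next point x in which
  \<open>X\<close> grows to \<open>insert x X\<close>. Keeping the error proportional to the product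
  of \<open>val_prob\<close> over \<open>X\<close> lets this sum close up: the new factor adds up to
  \<open>mean_sat m\<close>, which cancels against the normalisation of the sample.\<close>

lemma transcript_close:
  fixes m q L :: nat
  assumes m: "1 < m"
  defines "W \<equiv> \<lambda>s X D. E (law m s) (\<lambda>F. (\<Prod>x\<in>X. of_bool (glue m F x)) * pmf (run_det (4 * m) (glue m F) D) True)"
    and "e0 \<equiv> 16 / 3 * (4 * (real q)\<^sup>2 / 2 ^ L + 2 * real q * (real L + 2) / (4 * real m))"
    and "\<eta> \<equiv> (2 * sqrt (real (card (upper m)) * 2 ^ m) + real q * 2 ^ m) / mean_sat m"
  assumes "det_calls_le (4 * m) D r" "X \<subseteq> cube (4 * m)" "inj_on (take (3 * m)) X" "card X + r \<le> q"
    "\<And>x. x \<in> X \<Longrightarrow> val_prob m x \<noteq> 0"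
  shows "\<bar>W True X D - W False X D\<bar> \<le> (\<Prod>x\<in>X. val_prob m x) * (e0 + real r * (\<eta> * (16 / 3) ^ q))"
  using assms(5-)
proof (induction D arbitrary: r X)
  case (Round xs d)
  have m0: "0 < m" using m by simp
  have fX: "finite X" using Round finite_cube finite_subset by blast
  have c: "card (set xs) \<le> q" using Round card_length[of xs] by simp
  have Xp: "\<And>x. x \<in> X \<Longrightarrow> val_prob m x \<noteq> 0" by fact
  have P0: "0 \<le> (\<Prod>x\<in>X. val_prob m x)"
    using val_prob_01[OF m0] Round by (intro prod_nonneg) auto
  have \<eta>0: "0 \<le> \<eta>" using mean_sat_pos[OF m] by (simp add: \<eta>_def)
  have "\<bar>W True X (Round xs d) - W False X (Round xs d)\<bar> \<le> (\<Prod>x\<in>X. val_prob m x) * e0"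
    using round_close[OF m0 fX Round(2,3) _ c _ _ _ Xp, of "\<lambda>f. of_bool (d (map f xs))" L] Round(1)
    unfolding W_def e0_def by (simp add: indicator_def of_bool_def cong: map_cong)
  also have "\<dots> \<le> (\<Prod>x\<in>X. val_prob m x) * (e0 + real r * (\<eta> * (16 / 3) ^ q))"
    using P0 \<eta>0 by (intro mult_left_mono) auto
  finally show ?case .
next
  case (Samp k)
  have m0: "0 < m" using m by simp
  have fX: "finite X" using Samp finite_cube finite_subset by blast
  define h where "h = \<eta> * (16 / 3) ^ q"
  define P where "P = (\<Prod>x\<in>X. val_prob m x)"
  define I where "I F = (\<Prod>x\<in>X. of_bool (glue m F x) :: real)" for F
  define acc where "acc F x = pmf (run_det (4 * m) (glue m F) (k x)) True" for F x
  define W' where "W' s x = E (law m s) (\<lambda>F. I F * (of_bool (glue m F x) * acc F x))" for s x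
  let ?s0 = "mean_sat m" and ?v = "sqrt (real (card (upper m)) * 2 ^ m)"
  have s0: "0 < ?s0" using mean_sat_pos m by simp
  have I01: "0 \<le> I F" "I F \<le> 1" for F unfolding I_def by (auto intro!: prod_nonneg prod_le_1)
  have acc01: "0 \<le> acc F x" "acc F x \<le> 1" for F x by (auto simp: acc_def pmf_le_1)
  have fin: "finite (set_pmf (law m s))" for s using m0 by simp
  have P_ge: "(3 / 16) ^ q \<le> P"
  proof -
    have "(3 / 16 :: real) ^ q \<le> (3 / 16) ^ card X" using Samp(5) by (intro power_decreasing) auto
    also have "\<dots> = (\<Prod>x\<in>X. 3 / 16)" by simp
    also have "\<dots> \<le> P" unfolding P_def using val_prob_ge[OF m0] Samp(3,6) by (intro prod_mono) auto
    finally show ?thesis .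
  qed
  have P1: "P \<le> 1" "0 \<le> P" unfolding P_def using val_prob_01[OF m0] Samp(3)
    by (auto intro!: prod_le_1 prod_nonneg)
  have e0: "0 \<le> e0" by (simp add: e0_def)
  have \<eta>0: "0 \<le> \<eta>" using s0 by (simp add: \<eta>_def)
  have h0: "0 \<le> h" using \<eta>0 by (simp add: h_def)
  have W'01: "0 \<le> W' s x" "W' s x \<le> val_prob m x" if "x \<in> cube (4 * m)" for s x
  proof -
    show "0 \<le> W' s x" unfolding W'_def using I01 acc01 by (intro E_nonneg) auto
    have "W' s x \<le> E (law m s) (\<lambda>F. of_bool (glue m F x))"
      unfolding W'_def using I01 acc01 by (intro E_mono fin) (auto intro: mult_le_one)
    thus "W' s x \<le> val_prob m x" using E_law_value[OF m0 that] by simp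
  qed
  \<comment> \<open>The random normalisation by the number of satisfying points is replaced by
    \<open>mean_sat m\<close>. As the sum is at most that number, the loss is at most its relative
    deviation from the mean.\<close>
  have step: "\<bar>W s X (Samp k) - (\<Sum>x\<in>cube (4 * m). W' s x) / ?s0\<bar> \<le> ?v / ?s0" for s
  proof -
    have "(\<Sum>x\<in>cube (4 * m). W' s x) / ?s0
        = E (law m s) (\<lambda>F. I F * ((\<Sum>x\<in>cube (4 * m). of_bool (glue m F x) * acc F x) / ?s0))"
      unfolding W'_def E_sum[OF fin, symmetric]
      by (simp only: sum_distrib_left times_divide_eq_right Bochner_Integration.integral_divide_zero)
    moreover have "W s X (Samp k) = E (law m s) (\<lambda>F. I F * ((\<Sum>x\<in>cube (4 * m). of_bool (glue m F x) * acc F x)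
        / real (card (sat (4 * m) (glue m F)))))"
      unfolding W_def I_def acc_def
    proof (intro E_cong arg_cong2[where f = "(*)"] refl run_Samp)
      fix F assume "F \<in> set_pmf (law m s)"
      thus "sat (4 * m) (glue m F) \<noteq> {}" using ones_sat[of F m s] m by auto
    qed
    moreover have "\<bar>E (law m s) (\<lambda>F. I F * ((\<Sum>x\<in>cube (4 * m). of_bool (glue m F x) * acc F x)
        / real (card (sat (4 * m) (glue m F)))))
       - E (law m s) (\<lambda>F. I F * ((\<Sum>x\<in>cube (4 * m). of_bool (glue m F x) * acc F x) / ?s0))\<bar>
      \<le> E (law m s) (\<lambda>F. \<bar>real (card (sat (4 * m) (glue m F))) - ?s0\<bar> * (1 / ?s0))"
    proof (intro E_abs_diff_le fin)
      fix F assume F: "F \<in> set_pmf (law m s)"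
      let ?c = "real (card (sat (4 * m) (glue m F)))"
      define T where "T = (\<Sum>x\<in>cube (4 * m). of_bool (glue m F x) * acc F x)"
      have c0: "0 < ?c" using ones_sat[OF F m] by (auto simp: card_gt_0_iff)
      have "T \<le> (\<Sum>x\<in>cube (4 * m). of_bool (glue m F x))"
        unfolding T_def using acc01 by (intro sum_mono) (auto intro: mult_left_le)
      also have "\<dots> = ?c" by (simp add: of_bool_def sum.If_cases sat_def Int_def)
      finally have T: "0 \<le> T" "T \<le> ?c" using acc01 by (auto simp: T_def intro!: sum_nonneg)
      have "u * (T / c) - u * (T / s) = u * (T / c) * ((s - c) * (1 / s))"
        if "0 < c" "0 < s" for u c s :: real
        using that by (simp add: field_simps)
      from this[OF c0 s0]
      have "I F * (T / ?c) - I F * (T / ?s0) = I F * (T / ?c) * ((?s0 - ?c) * (1 / ?s0))" .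
      moreover have "\<bar>I F * (T / ?c)\<bar> \<le> 1"
        using T c0 I01[of F] unfolding abs_mult by (intro mult_le_one) auto
      hence "\<bar>I F * (T / ?c)\<bar> * \<bar>(?s0 - ?c) * (1 / ?s0)\<bar> \<le> 1 * \<bar>(?s0 - ?c) * (1 / ?s0)\<bar>"
        by (intro mult_right_mono) auto
      ultimately show "\<bar>I F * (T / ?c) - I F * (T / ?s0)\<bar> \<le> \<bar>?c - ?s0\<bar> * (1 / ?s0)"
        using s0 by (simp add: abs_mult abs_minus_commute)
    qed
    moreover have "E (law m s) (\<lambda>F. \<bar>real (card (sat (4 * m) (glue m F))) - ?s0\<bar> * (1 / ?s0)) \<le> ?v / ?s0"
      using sat_concentrated[OF m, of s] s0 by (simp add: divide_right_mono)
    ultimately show ?thesis by linarith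
  qed
  \<comment> \<open>A point in a block that was already sampled is charged in full, and
    \<open>coll\<close> bounds the number of such points. For a point in a new block the induction
    hypothesis applies with this point added to \<open>X\<close>.\<close>
  have one: "\<bar>W' True x - W' False x\<bar> \<le> P * val_prob m x * (e0 + real (r - 1) * h)
      + (if take (3 * m) x \<in> take (3 * m) ` X then 1 else 0)" if x: "x \<in> cube (4 * m)" for x
  proof -
    have v: "0 \<le> val_prob m x" "val_prob m x \<le> 1" using val_prob_01[OF m0 x] by auto
    have B0: "0 \<le> P * val_prob m x * (e0 + real (r - 1) * h)"
      using P1 v e0 h0 by simp
    consider "val_prob m x = 0" | "take (3 * m) x \<in> take (3 * m) ` X"
      | "val_prob m x \<noteq> 0" "take (3 * m) x \<notin> take (3 * m) ` X" by blast
    thus ?thesis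
    proof cases
      case 1
      hence "W' True x = 0" "W' False x = 0" using W'01[OF x] by (auto intro: antisym)
      thus ?thesis using B0 by simp
    next
      case 2
      have "\<bar>W' True x - W' False x\<bar> \<le> 1" using W'01[OF x, of True] W'01[OF x, of False] v by linarith
      thus ?thesis using B0 2 by simp
    next
      case 3
      have xX: "x \<notin> X" using 3 by blast
      have W'W: "W' s x = W s (insert x X) (k x)" for s
        unfolding W'_def W_def I_def acc_def using fX xX by (simp add: mult_ac)
      have "\<bar>W True (insert x X) (k x) - W False (insert x X) (k x)\<bar>
         \<le> (\<Prod>x\<in>insert x X. val_prob m x) * (e0 + real (r - 1) * (\<eta> * (16 / 3) ^ q))"
      proof (rule Samp.IH)
        show "det_calls_le (4 * m) (k x) (r - 1)" using Samp(2) x by simp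
        show "insert x X \<subseteq> cube (4 * m)" using Samp(3) x by simp
        show "inj_on (take (3 * m)) (insert x X)" using Samp(4) 3 xX by (simp add: inj_on_insert)
        show "card (insert x X) + (r - 1) \<le> q" using Samp(2,5) fX xX by simp
        show "\<And>y. y \<in> insert x X \<Longrightarrow> val_prob m y \<noteq> 0" using Samp(6) 3 by auto
      qed simp
      thus ?thesis using 3 fX xX by (simp add: W'W h_def P_def mult_ac)
    qed
  qed
  have coll: "(\<Sum>x\<in>cube (4 * m). if take (3 * m) x \<in> take (3 * m) ` X then 1 else 0) \<le> real q * 2 ^ m"
  proof -
    let ?C = "{x \<in> cube (4 * m). take (3 * m) x \<in> take (3 * m) ` X}"
    have "card ?C \<le> card (take (3 * m) ` X \<times> cube m)"
    proof (rule card_inj_on_le[where f = "\<lambda>x. (take (3 * m) x, drop (3 * m) x)"])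
      show "inj_on (\<lambda>x. (take (3 * m) x, drop (3 * m) x)) ?C"
        by (auto simp: inj_on_def) (metis append_take_drop_id)
      show "(\<lambda>x. (take (3 * m) x, drop (3 * m) x)) ` ?C \<subseteq> take (3 * m) ` X \<times> cube m"
        by (auto simp: cube_def)
    qed (use fX in auto)
    also have "\<dots> \<le> q * 2 ^ m"
      using card_image_le[OF fX, of "take (3 * m)"] Samp(5) by (simp add: card_cartesian_product)
    finally have "real (card ?C) \<le> real (q * 2 ^ m)" by (rule of_nat_mono)
    thus ?thesis by (simp add: sum.If_cases Int_def)
  qed
  have "\<bar>(\<Sum>x\<in>cube (4 * m). W' True x) - (\<Sum>x\<in>cube (4 * m). W' False x)\<bar>
     \<le> (\<Sum>x\<in>cube (4 * m). \<bar>W' True x - W' False x\<bar>)"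
    unfolding sum_subtractf[symmetric] by (rule sum_abs)
  also have "\<dots> \<le> (\<Sum>x\<in>cube (4 * m). P * val_prob m x * (e0 + real (r - 1) * h)
      + (if take (3 * m) x \<in> take (3 * m) ` X then 1 else 0))"
    by (intro sum_mono one)
  also have "\<dots> \<le> ?s0 * (P * (e0 + real (r - 1) * h)) + real q * 2 ^ m"
    unfolding sum.distrib using coll
    by (simp add: mean_sat_def sum_distrib_left sum_distrib_right mult_ac)
  finally have "\<bar>(\<Sum>x\<in>cube (4 * m). W' True x) - (\<Sum>x\<in>cube (4 * m). W' False x)\<bar> / ?s0
     \<le> (?s0 * (P * (e0 + real (r - 1) * h)) + real q * 2 ^ m) / ?s0"
    using s0 by (intro divide_right_mono) auto
  also have "\<dots> = P * (e0 + real (r - 1) * h) + real q * 2 ^ m / ?s0"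
    using s0 by (simp add: add_divide_distrib)
  finally have "\<bar>(\<Sum>x\<in>cube (4 * m). W' True x) / ?s0 - (\<Sum>x\<in>cube (4 * m). W' False x) / ?s0\<bar>
     \<le> P * (e0 + real (r - 1) * h) + real q * 2 ^ m / ?s0"
    using s0 by (simp flip: diff_divide_distrib add: abs_divide)
  with step[of True] step[of False]
  have "\<bar>W True X (Samp k) - W False X (Samp k)\<bar>
     \<le> P * (e0 + real (r - 1) * h) + real q * 2 ^ m / ?s0 + ?v / ?s0 + ?v / ?s0" by linarith
  also have "\<dots> = P * (e0 + real (r - 1) * h) + \<eta>"
    by (simp add: \<eta>_def add_divide_distrib)
  \<comment> \<open>The additive loss of one step is made proportional to \<open>P\<close>. As
    \<open>P\<close> can be as small as (3/16)^q, this costs the factor (16/3)^q in the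
    bound.\<close>
  also have "\<eta> \<le> P * h"
  proof -
    have "\<eta> = (3 / 16) ^ q * h" by (simp add: h_def flip: power_mult_distrib)
    also have "\<dots> \<le> P * h" using P_ge h0 by (intro mult_right_mono) auto
    finally show ?thesis .
  qed
  also have "P * (e0 + real (r - 1) * h) + P * h = P * (e0 + real r * h)"
    using Samp(2) by (simp add: algebra_simps of_nat_diff)
  finally show ?case by (simp add: P_def h_def)
qed

section \<open>Distance from unateness\<close>

definition chi :: "nat \<Rightarrow> nat set \<Rightarrow> point" where
  "chi n B = map (\<lambda>i. i \<in> B) [0..<n]"

lemma length_chi [simp]: "length (chi n B) = n"
  by (simp add: chi_def)

lemma nth_chi [simp]: "i < n \<Longrightarrow> chi n B ! i \<longleftrightarrow> i \<in> B"
  by (simp add: chi_def)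

lemma chi_cube [simp]: "chi n B \<in> cube n"
  by (simp add: cube_def)

lemma wt_chi: "wt (chi n B) = card (B \<inter> {..<n})"
  unfolding wt_card by (intro arg_cong[where f = card]) auto

lemma take_chi: "k \<le> n \<Longrightarrow> take k (chi n B) = chi k B"
  by (simp add: chi_def take_map)

text \<open>A common lower bound for all counts below: four coordinates are reserved for adjusting
  weight and parity, the others carry an arbitrary set of size 3m - 2.\<close>

definition base_size :: "nat \<Rightarrow> nat" where
  "base_size m = (4 * m - 4) choose (3 * m - 2)"

lemma binomial_le_card:
  assumes "finite T" "finite U" "\<And>S. S \<subseteq> U \<Longrightarrow> card S = k \<Longrightarrow> \<phi> S \<in> T \<and> {i \<in> U. \<phi> S ! i} = S"
  shows "card U choose k \<le> card T"
proof -
  have "card U choose k = card {S. S \<subseteq> U \<and> card S = k}"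
    using assms(2) by (simp add: n_subsets)
  also have "\<dots> \<le> card T"
  proof (rule card_inj_on_le[where f = \<phi>])
    show "inj_on \<phi> {S. S \<subseteq> U \<and> card S = k}"
      using assms(3) by (intro inj_on_inverseI[where g = "\<lambda>x. {i \<in> U. x ! i}"]) auto
  qed (use assms in auto)
  finally show ?thesis .
qed

text \<open>\<open>\<phi> S\<close> makes the adjustment on the reserved coordinates
  \<open>R\<close>. Since \<open>S\<close> can be read off outside \<open>R\<close>, different sets
  give different points.\<close>

lemma base_size_le:
  assumes m: "2 \<le> m" and R: "R \<subseteq> {..<4 * m}" "card R = 4" and T: "finite T"
    and \<phi>: "\<And>S. S \<subseteq> {..<4 * m} - R \<Longrightarrow> card S = 3 * m - 2 \<Longrightarrow> \<phi> S \<subseteq> R \<and> chi (4 * m) (S \<union> \<phi> S) \<in> T"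
  shows "base_size m \<le> card T"
proof -
  have fR: "finite R" using R(2) by (simp add: card_ge_0_finite)
  have "card ({..<4 * m} - R) choose (3 * m - 2) \<le> card T"
  proof (rule binomial_le_card[where \<phi> = "\<lambda>S. chi (4 * m) (S \<union> \<phi> S)"])
    fix S assume S: "S \<subseteq> {..<4 * m} - R" "card S = 3 * m - 2"
    show "chi (4 * m) (S \<union> \<phi> S) \<in> T \<and> {i \<in> {..<4 * m} - R. chi (4 * m) (S \<union> \<phi> S) ! i} = S"
      using \<phi>[OF S] S(1) by auto
  qed (use T in auto)
  thus ?thesis using R fR by (simp add: base_size_def card_Diff_subset)
qed

text \<open>Coordinate 0 is set, r is left clear, and the last one is placed at 1, inside
  \<open>a\<close>, or at q, inside \<open>v\<close>, whichever makes the weight of \<open>a\<close>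
  even.\<close>

lemma card_gate_points:
  assumes m: "2 \<le> m" and r: "3 * m \<le> r" "r < 4 * m"
  shows "base_size m \<le> card {x \<in> cube (4 * m). wt x = 3 * m \<and> gate (take (3 * m) x) \<and> \<not> x ! r}"
proof -
  define q where "q = (if r = 3 * m then 3 * m + 1 else 3 * m)"
  have q: "3 * m \<le> q" "q < 4 * m" "q \<noteq> r" using m r by (auto simp: q_def)
  let ?\<phi> = "\<lambda>S. {0} \<union> (if even (card (insert 0 S \<inter> {..<3 * m})) then {q} else {1})"
  show ?thesis
  proof (rule base_size_le[OF m, where R = "{0, 1, q, r}" and \<phi> = ?\<phi>])
    fix S assume S: "S \<subseteq> {..<4 * m} - {0, 1, q, r}" "card S = 3 * m - 2"
    have fS: "finite S" using S(1) finite_subset by blast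
    define B where "B = S \<union> ?\<phi> S"
    have nin: "0 \<notin> S" "1 \<notin> S" "q \<notin> S" "r \<notin> S" using S by auto
    have B: "B \<subseteq> {..<4 * m} \<and> card B = 3 * m \<and> r \<notin> B \<and> 0 \<in> B \<and> even (card (B \<inter> {..<3 * m}))"
    proof (cases "even (card (insert 0 S \<inter> {..<3 * m}))")
      case True
      hence "B = insert q (insert 0 S)" unfolding B_def by auto
      moreover from this have "B \<inter> {..<3 * m} = insert 0 S \<inter> {..<3 * m}" using q by auto
      ultimately show ?thesis using True nin fS S q r m by auto
    next
      case False
      hence "B = insert 1 (insert 0 S)" unfolding B_def by auto
      moreover from this have "B \<inter> {..<3 * m} = insert 1 (insert 0 S \<inter> {..<3 * m})" using m by auto
      hence "card (B \<inter> {..<3 * m}) = Suc (card (insert 0 S \<inter> {..<3 * m}))" using nin fS by simp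
      ultimately show ?thesis using False nin fS S r m by auto
    qed
    hence w: "wt (chi (4 * m) B) = 3 * m" by (simp add: wt_chi Int_absorb2)
    have "gate (take (3 * m) (chi (4 * m) B))"
      using m B by (simp add: take_chi gate_nth wt_chi)
    moreover have "\<not> chi (4 * m) B ! r" using r B by simp
    moreover have "?\<phi> S \<subseteq> {0, 1, q, r}" by auto
    ultimately show "?\<phi> S \<subseteq> {0, 1, q, r}
       \<and> chi (4 * m) (S \<union> ?\<phi> S) \<in> {x \<in> cube (4 * m). wt x = 3 * m \<and> gate (take (3 * m) x) \<and> \<not> x ! r}"
      unfolding B_def[symmetric] using w by simp
  qed (use q r m in auto)
qed

text \<open>Increasing edges for every direction i, on which the function equals the threshold
  function. For i other than 0 the first bit is clear at both ends. For i = 0 the weight of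
  \<open>a\<close> is chosen even, so that setting the first bit makes it odd and the gate stays
  closed.\<close>

lemma card_trivial_edges:
  assumes m: "2 \<le> m" and i: "i < 4 * m"
  shows "base_size m \<le> card {x \<in> cube (4 * m). wt x = 3 * m \<and> \<not> x ! i \<and> \<not> gate (take (3 * m) x)
      \<and> \<not> gate (take (3 * m) (x[i := True]))}" (is "_ \<le> card ?T")
proof (cases "i = 0")
  case True
  let ?\<phi> = "\<lambda>S. {3 * m} \<union> (if even (card (S \<inter> {..<3 * m})) then {3 * m + 1} else {1})"
  show ?thesis
  proof (rule base_size_le[OF m, where R = "{0, 1, 3 * m, 3 * m + 1}" and \<phi> = ?\<phi>])
    fix S assume S: "S \<subseteq> {..<4 * m} - {0, 1, 3 * m, 3 * m + 1}" "card S = 3 * m - 2"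
    have fS: "finite S" using S(1) finite_subset by blast
    define B where "B = S \<union> ?\<phi> S"
    have nin: "0 \<notin> S" "1 \<notin> S" "3 * m \<notin> S" "3 * m + 1 \<notin> S" using S by auto
    have B: "B \<subseteq> {..<4 * m} \<and> card B = 3 * m \<and> 0 \<notin> B \<and> even (card (B \<inter> {..<3 * m}))"
    proof (cases "even (card (S \<inter> {..<3 * m}))")
      case True
      hence "B = insert (3 * m + 1) (insert (3 * m) S)" unfolding B_def by auto
      moreover from this have "B \<inter> {..<3 * m} = S \<inter> {..<3 * m}" by auto
      ultimately show ?thesis using True nin fS S m by auto
    next
      case False
      hence "B = insert 1 (insert (3 * m) S)" unfolding B_def by auto
      moreover from this have "B \<inter> {..<3 * m} = insert 1 (S \<inter> {..<3 * m})" using m by auto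
      hence "card (B \<inter> {..<3 * m}) = Suc (card (S \<inter> {..<3 * m}))" using nin fS by simp
      ultimately show ?thesis using False nin fS S m by auto
    qed
    hence w: "wt (chi (4 * m) B) = 3 * m" by (simp add: wt_chi Int_absorb2)
    have n0: "\<not> chi k B ! 0" if "0 < k" for k using B that by simp
    have "take (3 * m) ((chi (4 * m) B)[0 := True]) = (chi (3 * m) B)[0 := True]"
      by (simp add: take_update_swap take_chi)
    moreover have "wt ((chi (3 * m) B)[0 := True]) = Suc (wt (chi (3 * m) B))"
      using n0[of "3 * m"] m by (intro wt_update_True) auto
    ultimately have "odd (wt (take (3 * m) ((chi (4 * m) B)[0 := True])))"
      using B by (simp add: wt_chi)
    hence "\<not> gate (take (3 * m) ((chi (4 * m) B)[0 := True]))" by (simp add: gate_def)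
    moreover have "\<not> gate (take (3 * m) (chi (4 * m) B))"
      using n0[of "3 * m"] m by (simp add: take_chi gate_nth del: nth_chi)
    moreover have "?\<phi> S \<subseteq> {0, 1, 3 * m, 3 * m + 1}" by auto
    ultimately show "?\<phi> S \<subseteq> {0, 1, 3 * m, 3 * m + 1} \<and> chi (4 * m) (S \<union> ?\<phi> S) \<in> ?T"
      unfolding B_def[symmetric] using w True n0[of "4 * m"] m by (simp del: nth_chi)
  qed (use m in auto)
next
  case False
  obtain p p' where p: "p < 4 * m" "p' < 4 * m" "p \<noteq> p'" "p \<noteq> 0" "p' \<noteq> 0" "p \<noteq> i" "p' \<noteq> i"
  proof -
    consider "i = 1" | "i = 2" | "i \<noteq> 1" "i \<noteq> 2" by blast
    thus ?thesis
    proof cases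
      case 1 thus ?thesis using m by (intro that[of 2 3]) auto
    next
      case 2 thus ?thesis using m by (intro that[of 1 3]) auto
    next
      case 3 thus ?thesis using m by (intro that[of 1 2]) auto
    qed
  qed
  show ?thesis
  proof (rule base_size_le[OF m, where R = "{0, i, p, p'}" and \<phi> = "\<lambda>_. {p, p'}"])
    fix S assume S: "S \<subseteq> {..<4 * m} - {0, i, p, p'}" "card S = 3 * m - 2"
    have fS: "finite S" using S(1) finite_subset by blast
    let ?B = "S \<union> {p, p'}"
    have nin: "0 \<notin> S" "i \<notin> S" "p \<notin> S" "p' \<notin> S" using S by auto
    have "?B \<subseteq> {..<4 * m}" using S p by auto
    moreover have "card ?B = 3 * m" using nin fS S(2) p m by auto
    ultimately have w: "wt (chi (4 * m) ?B) = 3 * m" by (simp only: wt_chi Int_absorb2)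
    have n0: "\<not> x ! 0 \<Longrightarrow> length x = 4 * m \<Longrightarrow> \<not> gate (take (3 * m) x)" for x
      using m by (simp add: gate_nth)
    show "{p, p'} \<subseteq> {0, i, p, p'} \<and> chi (4 * m) ?B \<in> ?T"
    proof -
      have "\<not> gate (take (3 * m) (chi (4 * m) ?B))" by (rule n0) (use nin p m in auto)
      moreover have "\<not> gate (take (3 * m) ((chi (4 * m) ?B)[i := True]))"
        by (rule n0) (use nin p m False in auto)
      ultimately show ?thesis using w nin p i by auto
    qed
  qed (use p i m False in auto)
qed

lemma card_layer_above:
  assumes m: "2 \<le> m"
  shows "base_size m \<le> card {x \<in> cube (4 * m). wt x = 3 * m + 2}"
proof (rule base_size_le[OF m, where R = "{0, 1, 2, 3}" and \<phi> = "\<lambda>_. {0, 1, 2, 3}"])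
  fix S assume S: "S \<subseteq> {..<4 * m} - {0, 1, 2, 3}" "card S = 3 * m - 2"
  have fS: "finite S" using S(1) finite_subset by blast
  let ?B = "S \<union> {0, 1, 2, 3}"
  have "?B \<subseteq> {..<4 * m}" using S m by auto
  moreover have "card ?B = card S + card {0, 1, 2, 3 :: nat}"
    using S(1) fS by (intro card_Un_disjoint) auto
  hence "card ?B = 3 * m + 2" using S(2) m by simp
  ultimately have "wt (chi (4 * m) ?B) = 3 * m + 2" by (simp only: wt_chi Int_absorb2)
  thus "{0, 1, 2, 3} \<subseteq> {0, 1, 2, 3 :: nat} \<and> chi (4 * m) ?B \<in> {x \<in> cube (4 * m). wt x = 3 * m + 2}"
    by simp
qed (use m in auto)

lemma base_size_le_sat:
  assumes "F \<in> set_pmf (law m s)" "2 \<le> m"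
  shows "base_size m \<le> card (sat (4 * m) (glue m F))"
proof -
  have "{x \<in> cube (4 * m). wt x = 3 * m + 2} \<subseteq> sat (4 * m) (glue m F)"
    using glue_high[OF assms(1)] assms(2) by (auto simp: sat_def)
  from card_mono[OF _ this] card_layer_above[OF assms(2)] show ?thesis by simp
qed

lemma base_size_le_mean:
  assumes "2 \<le> m"
  shows "real (base_size m) \<le> mean_sat m"
proof -
  have "real (base_size m) \<le> (\<Sum>x\<in>{x \<in> cube (4 * m). wt x = 3 * m + 2}. val_prob m x)"
    using card_layer_above[OF assms] by (simp add: val_prob_def)
  also have "\<dots> \<le> mean_sat m"
    unfolding mean_sat_def using assms val_prob_01[of m] by (intro sum_mono2) auto
  finally show ?thesis .
qed

section \<open>Distance to unate functions from matchings of violated edges\<close>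

definition viol :: "nat \<Rightarrow> (point \<Rightarrow> bool) \<Rightarrow> point set" where
  "viol m f = {x \<in> cube (4 * m). f x \<and> (\<exists>i<4 * m. \<not> x ! i \<and> \<not> f (x[i := True]))}"

text \<open>The edges from x to \<open>y x\<close> are pairwise disjoint and each has an end in
  \<open>\<Delta>\<close>.\<close>

lemma card_le_by_edges:
  assumes "finite \<Delta>" "inj_on y S" "S \<inter> y ` S = {}" "\<And>x. x \<in> S \<Longrightarrow> x \<in> \<Delta> \<or> y x \<in> \<Delta>"
  shows "card S \<le> card \<Delta>"
proof (rule card_inj_on_le[where f = "\<lambda>x. if x \<in> \<Delta> then x else y x"])
  show "inj_on (\<lambda>x. if x \<in> \<Delta> then x else y x) S"
    using assms(2,3) by (fastforce simp: inj_on_def)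
qed (use assms in auto)

text \<open>If \<open>g\<close> decreases in some variable, it errs on each trivial increasing edge
  in that direction. Otherwise \<open>g\<close> is increasing in all variables and errs on each
  decreasing edge. In both cases the edges used form a matching.\<close>

lemma far_sym_diff:
  assumes F: "F \<in> set_pmf (law m False)" and m: "2 \<le> m" and g: "unate (4 * m) g"
  shows "min (card (viol m (glue m F))) (base_size m)
     \<le> card (sym_diff (sat (4 * m) (glue m F)) (sat (4 * m) g))"
proof -
  let ?f = "glue m F"
  let ?\<Delta> = "sym_diff (sat (4 * m) ?f) (sat (4 * m) g)"
  have m0: "0 < m" using m by simp
  have fin: "finite ?\<Delta>" by simp
  have upd: "x[i := True] \<in> cube (4 * m)" "x[i := False] = x"
    "wt (x[i := True]) = Suc (wt x)"
    if "x \<in> cube (4 * m)" "i < 4 * m" "\<not> x ! i" for x i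
    using that by (auto simp: cube_def wt_update_True) (metis list_update_id)
  have \<Delta>: "z \<in> ?\<Delta> \<longleftrightarrow> ?f z \<noteq> g z" if "z \<in> cube (4 * m)" for z
    using that by (auto simp: sat_def)
  show ?thesis
  proof (cases "\<exists>i<4 * m. \<forall>x\<in>cube (4 * m). antimono (\<lambda>b. g (x[i := b]))")
    case True
    then obtain i where i: "i < 4 * m" "\<And>x. x \<in> cube (4 * m) \<Longrightarrow> g (x[i := True]) \<Longrightarrow> g (x[i := False])"
      unfolding antimono_bool_iff by blast
    let ?S = "{x \<in> cube (4 * m). wt x = 3 * m \<and> \<not> x ! i \<and> \<not> gate (take (3 * m) x)
      \<and> \<not> gate (take (3 * m) (x[i := True]))}"
    have "card ?S \<le> card ?\<Delta>"
    proof (rule card_le_by_edges[OF fin, where y = "\<lambda>x. x[i := True]"])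
      show "inj_on (\<lambda>x. x[i := True]) ?S"
        using upd(2) i(1)
        by (intro inj_on_inverseI[where g = "\<lambda>x. x[i := False]"]) auto
      show "?S \<inter> (\<lambda>x. x[i := True]) ` ?S = {}" using upd(3) i(1) by auto
      fix x assume x: "x \<in> ?S"
      have "\<not> ?f x" using glue_no_gate[OF F _ m0, of x] x by auto
      moreover have "?f (x[i := True])"
        using glue_no_gate[OF F _ m0, of "x[i := True]"] x upd(1,3) i(1) by auto
      moreover have "g (x[i := True]) \<Longrightarrow> g x" using i(2)[of x] x upd(2)[of x i] i(1) by auto
      ultimately show "x \<in> ?\<Delta> \<or> x[i := True] \<in> ?\<Delta>" using \<Delta> x upd(1)[of x i] i(1) by auto
    qed
    thus ?thesis using card_trivial_edges[OF m i(1)] by simp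
  next
    case False
    hence mono: "g (x[i := False]) \<Longrightarrow> g (x[i := True])" if "x \<in> cube (4 * m)" "i < 4 * m" for x i
      using g that unfolding unate_def mono_bool_iff by blast
    define idx where "idx x = (SOME i. i < 4 * m \<and> \<not> x ! i \<and> \<not> ?f (x[i := True]))" for x
    have idx: "idx x < 4 * m" "\<not> x ! idx x" "\<not> ?f (x[idx x := True])" if "x \<in> viol m ?f" for x
      using someI_ex[of "\<lambda>i. i < 4 * m \<and> \<not> x ! i \<and> \<not> ?f (x[i := True])"] that
      by (auto simp: viol_def idx_def)
    have "card (viol m ?f) \<le> card ?\<Delta>"
    proof (rule card_le_by_edges[OF fin, where y = "\<lambda>x. x[idx x := True]"])
      show "inj_on (\<lambda>x. x[idx x := True]) (viol m ?f)"
      proof (rule inj_onI)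
        fix x x' assume x: "x \<in> viol m ?f" "x' \<in> viol m ?f" and eq: "x[idx x := True] = x'[idx x' := True]"
        show "x = x'"
          using x by (intro decreasing_edge_unique[OF F m0 _ idx(1,2)[OF x(1)] _ _ idx(1,2)[OF x(2)] _ eq idx(3)[OF x(1)]])
            (auto simp: viol_def)
      qed
      show "viol m ?f \<inter> (\<lambda>x. x[idx x := True]) ` viol m ?f = {}"
        using idx(3) by (auto simp: viol_def)
      fix x assume x: "x \<in> viol m ?f"
      hence xc: "x \<in> cube (4 * m)" "?f x" by (auto simp: viol_def)
      have "g x \<Longrightarrow> g (x[idx x := True])"
        using mono[OF xc(1) idx(1)[OF x]] upd(2)[OF xc(1) idx(1,2)[OF x]] by simp
      thus "x \<in> ?\<Delta> \<or> x[idx x := True] \<in> ?\<Delta>"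
        using idx[OF x] xc \<Delta> upd(1)[OF xc(1) idx(1,2)[OF x]] by auto
    qed
    thus ?thesis by simp
  qed
qed

section \<open>The number of decreasing edges\<close>

definition gate_pts :: "nat \<Rightarrow> point set" where
  "gate_pts m = {x \<in> cube (4 * m). wt x = 3 * m \<and> gate (take (3 * m) x)}"

text \<open>Restricted to directions inside the block, the violation at \<open>x\<close> depends on
  one block function only, as \<open>variance_law\<close> requires.\<close>

definition viol_block :: "nat \<Rightarrow> point \<Rightarrow> (point \<Rightarrow> bool) \<Rightarrow> real" where
  "viol_block m x h = of_bool (h (drop (3 * m) x) \<and>
     (\<exists>j<m. \<not> drop (3 * m) x ! j \<and> \<not> h ((drop (3 * m) x)[j := True])))"

lemma card_viol_ge:
  "(\<Sum>x\<in>gate_pts m. viol_block m x (F (take (3 * m) x))) \<le> real (card (viol m (glue m F)))"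
proof -
  have fin: "finite (gate_pts m)" by (simp add: gate_pts_def)
  have "(\<Sum>x\<in>gate_pts m. viol_block m x (F (take (3 * m) x)))
     = real (card {x \<in> gate_pts m. viol_block m x (F (take (3 * m) x)) = 1})"
    using fin by (auto simp: viol_block_def of_bool_def sum.If_cases intro!: arg_cong[where f = card])
  also have "{x \<in> gate_pts m. viol_block m x (F (take (3 * m) x)) = 1} \<subseteq> viol m (glue m F)"
  proof
    fix x assume "x \<in> {x \<in> gate_pts m. viol_block m x (F (take (3 * m) x)) = 1}"
    then obtain j where *: "x \<in> cube (4 * m)" "F (take (3 * m) x) (drop (3 * m) x)" "j < m"
      "\<not> drop (3 * m) x ! j" "\<not> F (take (3 * m) x) ((drop (3 * m) x)[j := True])"
      by (auto simp: gate_pts_def viol_block_def split: if_splits)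
    hence "3 * m + j < 4 * m" "\<not> x ! (3 * m + j)" "\<not> glue m F (x[3 * m + j := True])" "glue m F x"
      by (auto simp: glue_def cube_def drop_update_swap)
    thus "x \<in> viol m (glue m F)" using * unfolding viol_def by blast
  qed
  hence "real (card {x \<in> gate_pts m. viol_block m x (F (take (3 * m) x)) = 1}) \<le> real (card (viol m (glue m F)))"
    by (intro of_nat_mono card_mono) (auto simp: viol_def)
  finally show ?thesis .
qed

text \<open>Each zero j of the last part is a decreasing direction if the mask is even on it and
  clear at j, with probability at least 1/4, and the cell holds the antidictator of that coordinate,
  with probability 1/(8m). For a fixed mask these antidictators are disjoint events, so their
  probabilities add.\<close>

lemma E_viol_block:
  assumes m: "0 < m" and x: "x \<in> gate_pts m"
  shows "real (card {j. j < m \<and> \<not> drop (3 * m) x ! j}) / (32 * real m)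
     \<le> E (block_pmf m False (take (3 * m) x)) (viol_block m x)"
proof -
  define a where "a = take (3 * m) x"
  define v where "v = drop (3 * m) x"
  have xav: "x = a @ v" "a \<in> cube (3 * m)" "v \<in> cube m" "wt a + wt v = 3 * m" "gate a"
    using x by (auto simp: a_def v_def gate_pts_def cube_def wt_take_drop)
  have la: "length a = 3 * m" "length v = m" using xav by (auto simp: cube_def)
  let ?Z = "{j. j < m \<and> \<not> v ! j}"
  have C: "(\<Sum>j\<in>?Z. of_bool (even (wt (mask C v)) \<and> \<not> C ! j)) / (8 * real m)
     \<le> E (cells_pmf m False) (\<lambda>G. viol_block m x (block_fun m a C G))"
    if C: "C \<in> cube m" for C
  proof (cases "even (wt (mask C v))")
    case True
    let ?J = "{j. j < m \<and> \<not> v ! j \<and> \<not> C ! j}"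
    define h where "h c = (of_bool (c x \<and> (\<exists>j\<in>?J. \<not> c (x[3 * m + j := True]))) :: real)" for c
    have lC: "length C = m" using C by (simp add: cube_def)
    have "(\<Sum>j\<in>?Z. of_bool (even (wt (mask C v)) \<and> \<not> C ! j)) = real (card ?J)"
      using True by (simp add: of_bool_def sum.If_cases Int_def conj_assoc)
    also have "\<dots> = real (card ((+) (3 * m) ` ?J))" by (subst card_image) auto
    also have "\<dots> = (\<Sum>i\<in>(+) (3 * m) ` ?J. 1)" by simp
    also have "\<dots> \<le> (\<Sum>i\<in>(+) (3 * m) ` ?J. h (cell m False (True, i)) + h (cell m False (False, i)))"
    proof (intro sum_mono)
      fix i assume "i \<in> (+) (3 * m) ` ?J"
      then obtain j where j: "j \<in> ?J" "i = 3 * m + j" by blast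
      hence "cell m False (True, i) x" "\<not> cell m False (True, i) (x[3 * m + j := True])"
        using la by (auto simp: cell_def xav(1) nth_append nth_list_update)
      hence "h (cell m False (True, i)) = 1" using j by (auto simp: h_def)
      moreover have "0 \<le> h (cell m False (False, i))" by (simp add: h_def)
      ultimately show "1 \<le> h (cell m False (True, i)) + h (cell m False (False, i))" by linarith
    qed
    also have "\<dots> \<le> (\<Sum>i<4 * m. h (cell m False (True, i)) + h (cell m False (False, i)))"
      by (intro sum_mono2) (auto simp: h_def)
    finally have "(\<Sum>j\<in>?Z. of_bool (even (wt (mask C v)) \<and> \<not> C ! j)) / (8 * real m) \<le> E (cell_pmf m False) h"
      unfolding E_cell_pmf[OF m] using m by (intro divide_right_mono) auto
    also have "\<dots> = E (cells_pmf m False) (\<lambda>G. h (G (mask C v)))"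
      using C xav by (intro E_cells_component[symmetric] mask_cube)
    also have "\<dots> \<le> E (cells_pmf m False) (\<lambda>G. viol_block m x (block_fun m a C G))"
    proof (intro E_mono finite_cells_pmf m)
      fix G
      have 1: "block_fun m a C G v \<longleftrightarrow> G (mask C v) x"
        using xav True by (simp add: block_fun_def)
      have 2: "block_fun m a C G (v[j := True]) \<longleftrightarrow> G (mask C v) (x[3 * m + j := True])" if "j \<in> ?J" for j
      proof -
        have "mask C (v[j := True]) = mask C v" using that lC la by (intro mask_update_outside) auto
        moreover have "wt (v[j := True]) = Suc (wt v)" using that la by (intro wt_update_True) auto
        moreover have "a @ v[j := True] = x[3 * m + j := True]"
          using la by (simp add: xav(1) list_update_append)
        ultimately show ?thesis using xav True by (simp add: block_fun_def)
      qed
      show "h (G (mask C v)) \<le> viol_block m x (block_fun m a C G)"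
        using 1 2 by (auto simp: h_def viol_block_def v_def[symmetric])
    qed
    finally show ?thesis .
  next
    case False
    then show ?thesis by (auto simp: viol_block_def intro!: E_nonneg)
  qed
  have "real (card ?Z) / (32 * real m) = (\<Sum>j\<in>?Z. 1 / 4) / (8 * real m)"
    by simp
  also have "\<dots> \<le> (\<Sum>j\<in>?Z. E (pmf_of_set (cube m)) (\<lambda>C. of_bool (even (wt (mask C v)) \<and> \<not> C ! j))) / (8 * real m)"
    using xav by (intro divide_right_mono sum_mono even_clear_prob_ge) auto
  also have "\<dots> = E (pmf_of_set (cube m)) (\<lambda>C. (\<Sum>j\<in>?Z. of_bool (even (wt (mask C v)) \<and> \<not> C ! j)) / (8 * real m))"
    by (subst E_sum[symmetric]) (auto simp: set_pmf_of_set)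
  also have "\<dots> \<le> E (block_pmf m False a) (viol_block m x)"
    unfolding E_block_pmf[OF m] using C by (intro E_mono) (auto simp: set_pmf_of_set)
  finally show ?thesis by (simp add: a_def v_def)
qed

text \<open>Double counting of the pairs of a gated point and a zero in its last m coordinates:
  \<open>card_gate_points\<close> bounds them for each of the m coordinates.\<close>

lemma mean_viol:
  assumes m: "2 \<le> m"
  shows "real (base_size m) / 32 \<le> (\<Sum>x\<in>gate_pts m. E (block_pmf m False (take (3 * m) x)) (viol_block m x))"
proof -
  have fin: "finite (gate_pts m)" by (simp add: gate_pts_def)
  have "real m * real (base_size m) = (\<Sum>j<m. real (base_size m))" by simp
  also have "\<dots> \<le> (\<Sum>j<m. real (card {x \<in> gate_pts m. \<not> x ! (3 * m + j)}))"
    using card_gate_points[OF m] by (intro sum_mono of_nat_mono) (simp add: gate_pts_def conj_assoc)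
  also have "\<dots> = (\<Sum>j<m. \<Sum>x\<in>gate_pts m. of_bool (\<not> x ! (3 * m + j)))"
    using fin by (intro sum.cong refl) (simp add: of_bool_def sum.If_cases Int_def)
  also have "\<dots> = (\<Sum>x\<in>gate_pts m. \<Sum>j<m. of_bool (\<not> x ! (3 * m + j)))"
    by (rule sum.swap)
  also have "\<dots> = (\<Sum>x\<in>gate_pts m. real (card {j. j < m \<and> \<not> drop (3 * m) x ! j}))"
    by (intro sum.cong refl) (auto simp: of_bool_def sum.If_cases gate_pts_def cube_def intro!: arg_cong[where f = card])
  finally have "real m * real (base_size m) / (32 * real m)
      \<le> (\<Sum>x\<in>gate_pts m. real (card {j. j < m \<and> \<not> drop (3 * m) x ! j})) / (32 * real m)"
    using m by (intro divide_right_mono) auto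
  also have "\<dots> = (\<Sum>x\<in>gate_pts m. real (card {j. j < m \<and> \<not> drop (3 * m) x ! j}) / (32 * real m))"
    by (rule sum_divide_distrib)
  also have "\<dots> \<le> (\<Sum>x\<in>gate_pts m. E (block_pmf m False (take (3 * m) x)) (viol_block m x))"
    using m by (intro sum_mono E_viol_block) auto
  finally show ?thesis using m by simp
qed

text \<open>Chebyshev's inequality at half of the lower bound \<open>base_size m / 32\<close> for
  the mean.\<close>

lemma few_viol_prob:
  assumes m: "2 \<le> m" and b: "0 < base_size m"
  shows "E (law m False) (\<lambda>F. of_bool (real (card (viol m (glue m F))) < real (base_size m) / 64))
     \<le> real (card (upper m)) * 2 ^ m / (real (base_size m) / 64)\<^sup>2"
proof -
  let ?e = "(\<Sum>x\<in>gate_pts m. E (block_pmf m False (take (3 * m) x)) (viol_block m x))"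
  let ?V = "\<lambda>F. (\<Sum>x\<in>gate_pts m. viol_block m x (F (take (3 * m) x)))"
  let ?t = "real (base_size m) / 64"
  have t: "0 < ?t" using b by simp
  have "E (law m False) (\<lambda>F. of_bool (real (card (viol m (glue m F))) < ?t))
     \<le> E (law m False) (\<lambda>F. (?V F - ?e)\<^sup>2 * (1 / ?t\<^sup>2))"
  proof (intro E_mono)
    fix F
    have "?t\<^sup>2 \<le> (?V F - ?e)\<^sup>2" if "real (card (viol m (glue m F))) < ?t"
    proof -
      have "?t \<le> ?e - ?V F" using that card_viol_ge[of m F] mean_viol[OF m] by simp
      hence "?t\<^sup>2 \<le> (?e - ?V F)\<^sup>2" using t by (intro power_mono) auto
      thus ?thesis by (simp only: power2_commute)
    qed
    thus "of_bool (real (card (viol m (glue m F))) < ?t) \<le> (?V F - ?e)\<^sup>2 * (1 / ?t\<^sup>2)"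
      using t by (auto simp: le_divide_eq)
  qed (use m in simp)
  also have "\<dots> = E (law m False) (\<lambda>F. (?V F - ?e)\<^sup>2) * (1 / ?t\<^sup>2)" by simp
  also have "\<dots> \<le> (real (card (gate_pts m)) * 2 ^ m) * (1 / ?t\<^sup>2)"
    using m by (intro mult_right_mono variance_law) (auto simp: gate_pts_def viol_block_def)
  also have "\<dots> \<le> (real (card (upper m)) * 2 ^ m) * (1 / ?t\<^sup>2)"
    by (intro mult_right_mono of_nat_mono card_mono) (auto simp: gate_pts_def upper_def)
  finally show ?thesis by simp
qed

section \<open>The gap of a tester\<close>

lemma Suc_times_binomial_Suc: "Suc k * (n choose Suc k) = (n - k) * (n choose k)"
proof (cases n)
  case (Suc n')
  then show ?thesis using Suc_times_binomial_eq[of n' k] binomial_absorb_comp[of n k] by simp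
qed simp

text \<open>Four absorption steps lower the upper index from 4m to 4m - 4, the first two also the
  lower index. Their ratios are at most 4/3, 3/2, 4 and 5, with product 40.\<close>

lemma binomial_le_base_size:
  assumes "2 \<le> m"
  shows "real ((4 * m) choose (3 * m)) \<le> 64 * real (base_size m)"
proof -
  define c1 where "c1 = real ((4 * m - 1) choose (3 * m - 1))"
  define c2 where "c2 = real ((4 * m - 2) choose (3 * m - 2))"
  define c3 where "c3 = real ((4 * m - 3) choose (3 * m - 2))"
  define c4 where "c4 = real (base_size m)"
  have r: "real (4 * m - 1) = 4 * real m - 1" "real (3 * m - 1) = 3 * real m - 1"
    "real (4 * m - 2) = 4 * real m - 2" "real (4 * m - 3) = 4 * real m - 3" "real (m - 1) = real m - 1"
    using assms by (auto simp: of_nat_diff)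
  have "3 * m * ((4 * m) choose (3 * m)) = 4 * m * ((4 * m - 1) choose (3 * m - 1))"
    using Suc_times_binomial_eq[of "4 * m - 1" "3 * m - 1"] assms by (simp add: mult.commute)
  hence e1: "3 * real m * real ((4 * m) choose (3 * m)) = 4 * real m * c1"
    unfolding c1_def by (metis of_nat_mult of_nat_numeral)
  have "(3 * m - 1) * ((4 * m - 1) choose (3 * m - 1)) = (4 * m - 1) * ((4 * m - 2) choose (3 * m - 2))"
    using Suc_times_binomial_eq[of "4 * m - 2" "3 * m - 2"] assms
    by (simp add: mult.commute Suc_diff_Suc numeral_2_eq_2)
  hence e2: "(3 * real m - 1) * c1 = (4 * real m - 1) * c2"
    unfolding c1_def c2_def r[symmetric] by (metis of_nat_mult)
  have "m * ((4 * m - 2) choose (3 * m - 2)) = (4 * m - 2) * ((4 * m - 3) choose (3 * m - 2))"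
  proof -
    have "4 * m - 2 - (3 * m - 2) = m" "4 * m - 2 - 1 = 4 * m - 3" using assms by auto
    thus ?thesis using binomial_absorb_comp[of "4 * m - 2" "3 * m - 2"] by simp
  qed
  hence e3: "real m * c2 = (4 * real m - 2) * c3"
    unfolding c2_def c3_def r[symmetric] by (metis of_nat_mult)
  have "(m - 1) * ((4 * m - 3) choose (3 * m - 2)) = (4 * m - 3) * base_size m"
  proof -
    have "4 * m - 3 - (3 * m - 2) = m - 1" "4 * m - 3 - 1 = 4 * m - 4" using assms by auto
    thus ?thesis using binomial_absorb_comp[of "4 * m - 3" "3 * m - 2"] by (simp add: base_size_def)
  qed
  hence e4: "(real m - 1) * c3 = (4 * real m - 3) * c4"
    unfolding c3_def c4_def r[symmetric] by (metis of_nat_mult)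
  have pos: "0 \<le> c1" "0 \<le> c2" "0 \<le> c3" "0 \<le> c4" by (auto simp: c1_def c2_def c3_def c4_def)
  have m2: "2 \<le> real m" using assms by simp
  have "real ((4 * m) choose (3 * m)) = 4 / 3 * c1" using e1 m2 by simp
  moreover have "(3 * real m - 1) * c1 \<le> (3 * real m - 1) * (3 / 2 * c2)"
  proof -
    have "(4 * real m - 1) * c2 \<le> ((3 * real m - 1) * (3 / 2)) * c2"
      using m2 pos by (intro mult_right_mono) (auto simp: field_simps)
    thus ?thesis using e2 by (simp add: mult_ac)
  qed
  hence "c1 \<le> 3 / 2 * c2" using m2 by (subst (asm) mult_le_cancel_left_pos) auto
  moreover have "real m * c2 \<le> real m * (4 * c3)"
  proof -
    have "(4 * real m - 2) * c3 \<le> (real m * 4) * c3" using pos by (intro mult_right_mono) auto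
    thus ?thesis using e3 by (simp add: mult_ac)
  qed
  hence "c2 \<le> 4 * c3" using m2 by (subst (asm) mult_le_cancel_left_pos) auto
  moreover have "(real m - 1) * c3 \<le> (real m - 1) * (5 * c4)"
  proof -
    have "(4 * real m - 3) * c4 \<le> ((real m - 1) * 5) * c4" using m2 pos by (intro mult_right_mono) auto
    thus ?thesis using e4 by (simp add: mult_ac)
  qed
  hence "c3 \<le> 5 * c4" using m2 by (subst (asm) mult_le_cancel_left_pos) auto
  ultimately show ?thesis using pos by (simp add: c4_def[symmetric])
qed

lemma four_pow_le_binomial: "0 < m \<Longrightarrow> (4::real) ^ m \<le> real ((4 * m) choose (3 * m))"
  using binomial_ge_n_over_k_pow_k[of m "4 * m", where 'a = real]
    binomial_symmetric[of m "4 * m"] by simp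

lemma card_layer_le: "card {x \<in> cube n. wt x = j} \<le> n choose j"
proof -
  have "card {x \<in> cube n. wt x = j} \<le> card {S. S \<subseteq> {..<n} \<and> card S = j}"
  proof (rule card_inj_on_le[where f = "\<lambda>x. {i. i < n \<and> x ! i}"])
    show "inj_on (\<lambda>x. {i. i < n \<and> x ! i}) {x \<in> cube n. wt x = j}"
      by (rule inj_onI) (auto simp: cube_def list_eq_iff_nth_eq set_eq_iff)
  qed (auto simp: cube_def wt_card)
  thus ?thesis by (simp add: n_subsets)
qed

text \<open>Above layer 3m each layer is at most half as large as the one below, so the sizes are
  dominated by a geometric series.\<close>

lemma card_upper_le:
  assumes "0 < m"
  shows "real (card (upper m)) \<le> 2 * real ((4 * m) choose (3 * m))"
proof -
  let ?N = "real ((4 * m) choose (3 * m))"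
  have b: "real ((4 * m) choose (3 * m + i)) \<le> ?N * (1 / 2) ^ i" for i
  proof (induction i)
    case (Suc i)
    have "real (Suc (3 * m + i)) * real ((4 * m) choose Suc (3 * m + i))
        = real (4 * m - (3 * m + i)) * real ((4 * m) choose (3 * m + i))"
      using Suc_times_binomial_Suc[of "3 * m + i" "4 * m"] by (metis of_nat_mult)
    also have "\<dots> \<le> (real (Suc (3 * m + i)) / 2) * (?N * (1 / 2) ^ i)"
      using Suc by (intro mult_mono) auto
    finally have "real (Suc (3 * m + i)) * real ((4 * m) choose Suc (3 * m + i))
       \<le> real (Suc (3 * m + i)) * (?N * (1 / 2) ^ Suc i)" by (simp add: mult_ac)
    thus ?case by (subst (asm) mult_le_cancel_left_pos) auto
  qed simp
  have "upper m = (\<Union>i\<in>{..m}. {x \<in> cube (4 * m). wt x = 3 * m + i})" (is "_ = (\<Union>i\<in>_. ?L i)")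
  proof safe
    fix x assume x: "x \<in> upper m"
    hence "wt x = 3 * m + (wt x - 3 * m)" "wt x - 3 * m \<le> m"
      using wt_le[of x] by (auto simp: upper_def cube_def)
    thus "x \<in> (\<Union>i\<in>{..m}. ?L i)" using x unfolding upper_def by blast
  qed (auto simp: upper_def)
  hence "card (upper m) \<le> (\<Sum>i\<le>m. card (?L i))" using card_UN_le[of "{..m}" ?L] by simp
  hence "real (card (upper m)) \<le> real (\<Sum>i\<le>m. card (?L i))" by (rule of_nat_mono)
  also have "\<dots> = (\<Sum>i\<le>m. real (card (?L i)))" by simp
  also have "\<dots> \<le> (\<Sum>i\<le>m. ?N * (1 / 2) ^ i)"
    using b card_layer_le[of "4 * m"] by (intro sum_mono) (meson of_nat_le_iff order_trans)
  also have "\<dots> = ?N * (\<Sum>i\<le>m. (1 / 2) ^ i)" by (simp add: sum_distrib_left)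
  also have "\<dots> \<le> ?N * 2"
    by (intro mult_left_mono) (auto simp: sum_gp0)
  finally show ?thesis by simp
qed

text \<open>The constant is 64 * 128: at least \<open>base_size m / 64\<close> points must change,
  and there are at most 2N, hence at most \<open>128 * base_size m\<close>, satisfying
  points.\<close>

lemma reldist_unate_ge:
  assumes F: "F \<in> set_pmf (law m False)" and m: "2 \<le> m"
    and v: "real (base_size m) / 64 \<le> real (card (viol m (glue m F)))"
  shows "1 / 8192 \<le> reldist_unate (4 * m) (glue m F)"
  unfolding reldist_unate_def
proof (rule cINF_greatest)
  have "unate (4 * m) (\<lambda>_. False)" by (simp add: unate_def mono_def)
  thus "{g. unate (4 * m) g} \<noteq> {}" by blast
next
  fix g assume "g \<in> {g. unate (4 * m) g}"
  hence g: "unate (4 * m) g" by simp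
  let ?S = "sat (4 * m) (glue m F)"
  have "real (base_size m) / 64 \<le> real (min (card (viol m (glue m F))) (base_size m))"
    using v by (auto simp: min_def)
  also have "\<dots> \<le> real (card (sym_diff ?S (sat (4 * m) g)))"
    using far_sym_diff[OF F m g] by (rule of_nat_mono)
  finally have 1: "real (base_size m) / 64 \<le> real (card (sym_diff ?S (sat (4 * m) g)))" .
  have "card ?S \<le> card (upper m)"
    using sat_upper[OF F] m by (intro card_mono) auto
  hence "real (card ?S) \<le> 2 * real ((4 * m) choose (3 * m))"
    using card_upper_le[of m] m by (meson of_nat_le_iff order_trans zero_less_numeral order_less_le_trans)
  also have "\<dots> \<le> 128 * real (base_size m)" using binomial_le_base_size[OF m] by simp
  finally have 2: "real (card ?S) \<le> 8192 * real (card (sym_diff ?S (sat (4 * m) g)))" using 1 by linarith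
  have "0 < card ?S" using ones_sat[OF F] m by (auto simp: card_gt_0_iff)
  thus "1 / 8192 \<le> reldist (4 * m) (glue m F) g"
    unfolding reldist_def using 2 by (simp add: field_simps)
qed

lemma pmf_bool_sum: "pmf p True + pmf p False = 1" for p :: "bool pmf"
proof -
  have "(\<Sum>b\<in>UNIV. pmf p b) = 1" by (rule sum_pmf_eq_1) auto
  thus ?thesis by (simp add: UNIV_bool)
qed

lemma integrable_pmf_value: "integrable (measure_pmf A) (\<lambda>D. pmf (f D) b)"
  by (rule measure_pmf.integrable_const_bound[where B = 1]) (auto simp: pmf_le_1)

text \<open>A tester accepts with probability at least 2/3 on average over the unate law, and at
  most 1/3 plus the chance of too few violations over the far law. The gap is bounded by
  \<open>transcript_close\<close> for the empty set of samples.\<close>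

lemma tester_gap:
  assumes m: "2 \<le> m"
    and T: "unate_tester (4 * m) {f. 1 / 64 * N \<le> real (card (sat (4 * m) f)) \<and> real (card (sat (4 * m) f)) \<le> 2 * N}
        (1 / 8192) A"
    and calls: "calls_le (4 * m) A q" and N: "N = real ((4 * m) choose (3 * m))"
  shows "1 / 3 \<le> 16 / 3 * (4 * (real q)\<^sup>2 / 2 ^ L + 2 * real q * (real L + 2) / (4 * real m))
     + real q * ((2 * sqrt (real (card (upper m)) * 2 ^ m) + real q * 2 ^ m) / mean_sat m * (16 / 3) ^ q)
     + real (card (upper m)) * 2 ^ m / (real (base_size m) / 64)\<^sup>2" (is "_ \<le> ?B + ?p")
proof -
  let ?n = "4 * m"
  let ?acc = "\<lambda>D F. pmf (run_det ?n (glue m F) D) True"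
  let ?R = "\<lambda>F. pmf (run ?n (glue m F) A) True"
  have m0: "0 < m" and m1: "1 < m" using m by auto
  have fin: "finite (set_pmf (law m s))" for s using m0 by simp
  have cls: "glue m F \<in> {f. 1 / 64 * N \<le> real (card (sat (4 * m) f)) \<and> real (card (sat (4 * m) f)) \<le> 2 * N}"
    if F: "F \<in> set_pmf (law m s)" for F s
  proof -
    have "real (base_size m) \<le> real (card (sat ?n (glue m F)))"
      using base_size_le_sat[OF F m] by (rule of_nat_mono)
    moreover have "card (sat ?n (glue m F)) \<le> card (upper m)"
      using sat_upper[OF F m0] by (intro card_mono) auto
    hence "real (card (sat ?n (glue m F))) \<le> real (card (upper m))" by (rule of_nat_mono)
    ultimately show ?thesis using binomial_le_base_size[OF m] card_upper_le[OF m0] N by simp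
  qed
  have Y: "2 / 3 \<le> E (law m True) ?R"
  proof -
    have "E (law m True) (\<lambda>_. 2 / 3) \<le> E (law m True) ?R"
    proof (intro E_mono fin)
      fix F assume F: "F \<in> set_pmf (law m True)"
      show "2 / 3 \<le> ?R F"
        using T cls[OF F] law_True_unate[OF F m0] unfolding unate_tester_def by blast
    qed
    thus ?thesis by simp
  qed
  have X: "E (law m False) ?R \<le> 1 / 3 + ?p"
  proof -
    have "E (law m False) ?R \<le> E (law m False) (\<lambda>F. 1 / 3
        + of_bool (real (card (viol m (glue m F))) < real (base_size m) / 64))"
    proof (intro E_mono fin)
      fix F assume F: "F \<in> set_pmf (law m False)"
      show "?R F \<le> 1 / 3 + of_bool (real (card (viol m (glue m F))) < real (base_size m) / 64)"
      proof (cases "real (card (viol m (glue m F))) < real (base_size m) / 64")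
        case True
        then show ?thesis using pmf_le_1[of "run ?n (glue m F) A" True] by simp
      next
        case False
        hence "1 / 8192 \<le> reldist_unate ?n (glue m F)"
          using reldist_unate_ge[OF F m] by simp
        hence "2 / 3 \<le> pmf (run ?n (glue m F) A) False"
          using T cls[OF F] unfolding unate_tester_def by blast
        then show ?thesis using False pmf_bool_sum[of "run ?n (glue m F) A"] by simp
      qed
    qed
    also have "\<dots> = 1 / 3 + E (law m False) (\<lambda>F. of_bool (real (card (viol m (glue m F))) < real (base_size m) / 64))"
      using fin by (subst E_add) auto
    also have "\<dots> \<le> 1 / 3 + ?p"
    proof -
      have "0 < (4::real) ^ m" by simp
      hence "0 < base_size m"
        using four_pow_le_binomial[OF m0] binomial_le_base_size[OF m] by linarith
      thus ?thesis using few_viol_prob[OF m] by simp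
    qed
    finally show ?thesis .
  qed
  \<comment> \<open>A randomized algorithm may have infinite support, so the exchange goes through a
    finite sum over the support of the law.\<close>
  have swap: "E (law m s) ?R = E A (\<lambda>D. E (law m s) (?acc D))" for s
  proof -
    have "E (law m s) ?R = (\<Sum>F\<in>set_pmf (law m s). ?R F * pmf (law m s) F)"
      using fin by (intro integral_measure_pmf_real) auto
    also have "\<dots> = (\<Sum>F\<in>set_pmf (law m s). E A (\<lambda>D. ?acc D F * pmf (law m s) F))"
      by (simp add: run_def pmf_bind)
    also have "\<dots> = E A (\<lambda>D. \<Sum>F\<in>set_pmf (law m s). ?acc D F * pmf (law m s) F)"
      by (intro Bochner_Integration.integral_sum[symmetric] integrable_mult_left integrable_pmf_value)
    also have "\<dots> = E A (\<lambda>D. E (law m s) (?acc D))"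
      using fin by (intro E_cong integral_measure_pmf_real[symmetric]) auto
    finally show ?thesis .
  qed
  have int: "integrable (measure_pmf A) (\<lambda>D. E (law m s) (?acc D))" for s
  proof (rule measure_pmf.integrable_const_bound[where B = 1])
    have "\<bar>E (law m s) (?acc D)\<bar> \<le> E (law m s) (\<lambda>_. 1)" for D
      using fin by (intro E_abs_le) (auto simp: pmf_le_1)
    thus "AE D in A. norm (E (law m s) (?acc D)) \<le> 1" by simp
  qed simp
  have "E (law m True) ?R - E (law m False) ?R = E A (\<lambda>D. E (law m True) (?acc D) - E (law m False) (?acc D))"
    unfolding swap using int by (intro Bochner_Integration.integral_diff[symmetric])
  also have "\<dots> \<le> E A (\<lambda>_. ?B)"
  proof (rule integral_mono_AE)
    show "AE D in A. E (law m True) (?acc D) - E (law m False) (?acc D) \<le> ?B"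
      unfolding AE_measure_pmf_iff
    proof
      fix D assume "D \<in> set_pmf A"
      hence "det_calls_le ?n D q" using calls by (simp add: calls_le_def)
      from transcript_close[OF m1 this, of "{}" q L]
      show "E (law m True) (?acc D) - E (law m False) (?acc D) \<le> ?B" by simp
    qed
  qed (use int in auto)
  finally have "E (law m True) ?R - E (law m False) ?R \<le> ?B" by simp
  thus ?thesis using X Y by linarith
qed

section \<open>Asymptotics\<close>

text \<open>The q^2 term vanishes, the term linear in q tends to 16/3 * 12/4000 = 0.016, and
  2^(-m/2) beats 2^(3m/1000).\<close>

lemma eventually_small:
  "\<forall>\<^sub>F m in sequentially.
     16 / 3 * (4 * (real m)\<^sup>2 / real m ^ 3
       + 2 * (real m / (1000 * ln (real m))) * (6 * ln (real m) + 3) / (4 * real m))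
     + real m * (64 * (4 * 2 powr (- real m / 2) + real m * 2 powr (- real m)) * 2 powr (3 * real m / 1000))
     + 2 * 4096\<^sup>2 / 2 powr real m < 1 / 3"
  by real_asymp

text \<open>\<open>L\<close> is chosen so that 2^L is at least m^3, which defeats the union bound
  over q^2 pairs, while L remains logarithmic and costs only the factor ln m in the final bound. For
  the power (16/3)^q, 16/3 is rounded up to 2^3.\<close>

lemma error_bound:
  assumes m: "3 \<le> m" and q: "real q \<le> real m / (1000 * ln (real m))"
  defines "L \<equiv> nat \<lceil>3 * log 2 (real m)\<rceil>"
  shows "16 / 3 * (4 * (real q)\<^sup>2 / 2 ^ L + 2 * real q * (real L + 2) / (4 * real m))
     + real q * ((2 * sqrt (real (card (upper m)) * 2 ^ m) + real q * 2 ^ m) / mean_sat m * (16 / 3) ^ q)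
     + real (card (upper m)) * 2 ^ m / (real (base_size m) / 64)\<^sup>2
    \<le> 16 / 3 * (4 * (real m)\<^sup>2 / real m ^ 3
       + 2 * (real m / (1000 * ln (real m))) * (6 * ln (real m) + 3) / (4 * real m))
     + real m * (64 * (4 * 2 powr (- real m / 2) + real m * 2 powr (- real m)) * 2 powr (3 * real m / 1000))
     + 2 * 4096\<^sup>2 / 2 powr real m"
proof -
  let ?N = "real ((4 * m) choose (3 * m))"
  let ?t = "2 powr real m"
  have t: "?t = 2 ^ m" by (simp add: powr_realpow)
  have t0: "0 < ?t" by simp
  have m3: "3 \<le> real m" using m by simp
  have ln1: "1 \<le> ln (real m)"
  proof -
    have "exp 1 \<le> real m" using exp_le m3 by linarith
    thus ?thesis using m3 by (subst ln_ge_iff) auto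
  qed
  have q1: "real q \<le> real m / 1000"
  proof -
    have "real m / (1000 * ln (real m)) \<le> real m / (1000 * 1)"
      using ln1 m3 by (intro divide_left_mono mult_left_mono) auto
    thus ?thesis using q by simp
  qed
  have qm: "real q \<le> real m" using q1 m3 by simp
  have N4: "?t * ?t \<le> ?N"
    using four_pow_le_binomial[of m] m by (simp add: t flip: power_mult_distrib)
  have N0: "0 < ?N" using N4 t0 by (meson less_le_trans mult_pos_pos)
  have tN: "?t \<le> ?N / ?t" using N4 t0 by (simp add: pos_le_divide_eq)
  have bN: "?N / 64 \<le> real (base_size m)" using binomial_le_base_size[of m] m by simp
  have sN: "?N / 64 \<le> mean_sat m" using bN base_size_le_mean[of m] m by simp
  have uN: "real (card (upper m)) \<le> 2 * ?N" using card_upper_le[of m] m by simp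
  have "log 2 (real m) \<le> 2 * ln (real m)"
  proof -
    have "ln (real m) / ln 2 \<le> ln (real m) / (1 / 2)"
      using ln1 ln2_ge_two_thirds by (intro divide_left_mono) auto
    thus ?thesis by (simp add: log_def)
  qed
  hence lg: "3 * log 2 (real m) \<le> 6 * ln (real m)" by simp
  have log0: "0 \<le> log 2 (real m)" using m3 by simp
  have L: "3 * log 2 (real m) \<le> real L" "real L \<le> 3 * log 2 (real m) + 1"
    using log0 unfolding L_def by (auto simp: of_nat_nat)
  have "real m ^ 3 = (2 powr log 2 (real m)) powr 3"
    using m3 by simp
  also have "\<dots> = 2 powr (3 * log 2 (real m))" by (simp only: powr_powr mult.commute)
  also have "\<dots> \<le> 2 powr real L" using L by simp
  finally have L3: "real m ^ 3 \<le> 2 ^ L" by (simp add: powr_realpow)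
  have "4 * (real q)\<^sup>2 / 2 ^ L \<le> 4 * (real m)\<^sup>2 / real m ^ 3"
    using L3 m3 qm by (intro frac_le mult_left_mono power_mono) auto
  moreover have "2 * real q * (real L + 2) / (4 * real m)
      \<le> 2 * (real m / (1000 * ln (real m))) * (6 * ln (real m) + 3) / (4 * real m)"
    using q L lg ln1 m3 log0 by (intro divide_right_mono mult_mono) auto
  ultimately have 1: "16 / 3 * (4 * (real q)\<^sup>2 / 2 ^ L + 2 * real q * (real L + 2) / (4 * real m))
     \<le> 16 / 3 * (4 * (real m)\<^sup>2 / real m ^ 3
       + 2 * (real m / (1000 * ln (real m))) * (6 * ln (real m) + 3) / (4 * real m))"
    by (intro mult_left_mono add_mono) auto
  have "sqrt (real (card (upper m)) * 2 ^ m) \<le> sqrt ((2 * ?N) * (?N / ?t))"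
    using uN tN N0 by (intro real_sqrt_le_mono mult_mono) (auto simp: t)
  also have "\<dots> \<le> ?N * (2 * 2 powr (- real m / 2))"
  proof (rule real_le_lsqrt)
    have "(2 powr (- real m / 2))\<^sup>2 = 1 / ?t"
      by (simp add: power2_eq_square flip: powr_add powr_minus_divide)
    hence "(?N * (2 * 2 powr (- real m / 2)))\<^sup>2 = 4 * (?N\<^sup>2 / ?t)"
      by (simp only: power_mult_distrib) simp
    moreover have "(2 * ?N) * (?N / ?t) = 2 * (?N\<^sup>2 / ?t)" by (simp add: power2_eq_square)
    moreover have "0 \<le> ?N\<^sup>2 / ?t" by simp
    ultimately show "(2 * ?N) * (?N / ?t) \<le> (?N * (2 * 2 powr (- real m / 2)))\<^sup>2" by linarith
  qed (use N0 in auto)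
  finally have s: "sqrt (real (card (upper m)) * 2 ^ m) \<le> ?N * (2 * 2 powr (- real m / 2))" .
  have r: "real q * 2 ^ m \<le> real m * (?N / ?t)"
    using qm tN by (intro mult_mono) (auto simp: t)
  have "(2 * sqrt (real (card (upper m)) * 2 ^ m) + real q * 2 ^ m) / mean_sat m
     \<le> (2 * (?N * (2 * 2 powr (- real m / 2))) + real m * (?N / ?t)) / (?N / 64)"
    using s r sN N0 by (intro frac_le add_mono mult_left_mono) auto
  also have "\<dots> = 64 * (4 * 2 powr (- real m / 2) + real m * 2 powr (- real m))"
    using N0 by (simp add: powr_minus_divide add_divide_distrib distrib_left)
  finally have \<eta>: "(2 * sqrt (real (card (upper m)) * 2 ^ m) + real q * 2 ^ m) / mean_sat m
     \<le> 64 * (4 * 2 powr (- real m / 2) + real m * 2 powr (- real m))" .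
  have "(16 / 3 :: real) ^ q \<le> (2 ^ 3) ^ q" by (intro power_mono) auto
  also have "\<dots> = 2 ^ (3 * q)" by (rule power_mult[symmetric])
  also have "\<dots> = 2 powr real (3 * q)" by (rule powr_realpow[symmetric]) simp
  also have "\<dots> \<le> 2 powr (3 * real m / 1000)" using q1 by simp
  finally have p: "(16 / 3 :: real) ^ q \<le> 2 powr (3 * real m / 1000)" .
  have s0: "0 < mean_sat m" using sN N0 by (meson divide_pos_pos less_le_trans zero_less_numeral)
  have 2: "real q * ((2 * sqrt (real (card (upper m)) * 2 ^ m) + real q * 2 ^ m) / mean_sat m * (16 / 3) ^ q)
     \<le> real m * (64 * (4 * 2 powr (- real m / 2) + real m * 2 powr (- real m)) * 2 powr (3 * real m / 1000))"
    using qm \<eta> p s0 by (intro mult_mono) auto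
  have "real (card (upper m)) * 2 ^ m / (real (base_size m) / 64)\<^sup>2
     \<le> (2 * ?N) * (?N / ?t) / (?N / 64 / 64)\<^sup>2"
    using uN tN bN N0 by (intro frac_le mult_mono power_mono divide_right_mono) (auto simp: t)
  also have "\<dots> = 2 * 4096\<^sup>2 / ?t" using N0 by (simp add: field_simps power2_eq_square)
  finally have 3: "real (card (upper m)) * 2 ^ m / (real (base_size m) / 64)\<^sup>2 \<le> 2 * 4096\<^sup>2 / ?t" .
  show ?thesis using 1 2 3 by linarith
qed

theorem theorem7p1:
  defines "N \<equiv> \<lambda>n::nat. real (n choose (3 * n div 4))"
  shows "\<exists>\<epsilon>\<^sub>0>0. \<exists>c\<^sub>1>0. \<exists>c\<^sub>2>0. \<exists>C>0. \<exists>k::nat. \<forall>\<^sub>F n in sequentially. 4 dvd n \<longrightarrow>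
    (\<forall>A q. unate_tester n {f. c\<^sub>1 * N n \<le> real (card (sat n f)) \<and> real (card (sat n f)) \<le> c\<^sub>2 * N n} \<epsilon>\<^sub>0 A
        \<and> calls_le n A q
      \<longrightarrow> real q \<ge> C * ln (N n) / ln (ln (N n)) ^ k)"
proof -
  obtain M where M: "\<And>m. M \<le> m \<Longrightarrow>
     16 / 3 * (4 * (real m)\<^sup>2 / real m ^ 3
       + 2 * (real m / (1000 * ln (real m))) * (6 * ln (real m) + 3) / (4 * real m))
     + real m * (64 * (4 * 2 powr (- real m / 2) + real m * 2 powr (- real m)) * 2 powr (3 * real m / 1000))
     + 2 * 4096\<^sup>2 / 2 powr real m < 1 / 3"
    using eventually_small unfolding eventually_sequentially by blast
  have main: "1 / 4000 * ln (N n) / ln (ln (N n)) ^ 1 \<le> real q"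
    if n: "4 * (M + 3) \<le> n" "4 dvd n" and
      T: "unate_tester n {f. 1 / 64 * N n \<le> real (card (sat n f)) \<and> real (card (sat n f)) \<le> 2 * N n} (1 / 8192) A"
        "calls_le n A q" for n A q
  proof (rule ccontr)
    assume "\<not> 1 / 4000 * ln (N n) / ln (ln (N n)) ^ 1 \<le> real q"
    hence q: "real q < 1 / 4000 * ln (N n) / ln (ln (N n))" by simp
    obtain m where nm: "n = 4 * m" using n(2) by blast
    have m: "3 \<le> m" "M \<le> m" using n(1) nm by auto
    have Nm: "N n = real ((4 * m) choose (3 * m))" by (simp add: N_def nm)
    have m2: "2 \<le> m" using m by simp
    have m0: "0 < ln (real m)" using m by simp
    have N4: "4 ^ m \<le> N n" using four_pow_le_binomial[of m] m Nm by simp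
    hence N0: "0 < N n" by (meson less_le_trans zero_less_numeral zero_less_power)
    have "real ((4 * m) choose (3 * m)) \<le> real (2 ^ (4 * m))"
      by (intro of_nat_mono) (rule binomial_le_pow2)
    hence "ln (N n) \<le> ln (2 ^ (4 * m))" using Nm N0 by (subst ln_le_cancel_iff) auto
    also have "\<dots> = real (4 * m) * ln 2" by (simp only: ln_realpow zero_less_numeral)
    also have "\<dots> \<le> real (4 * m) * 1" using ln_2_less_1 by (intro mult_left_mono) auto
    finally have lN: "ln (N n) \<le> 4 * real m" by simp
    have "exp (1::real) \<le> 4" using exp_le by simp
    hence "exp (real m) \<le> 4 ^ m" using power_mono[of "exp (1::real)" 4 m] by (simp add: exp_of_nat_mult[symmetric])
    hence "real m \<le> ln (N n)" using N4 N0 by (subst ln_ge_iff) auto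
    hence llN: "ln (real m) \<le> ln (ln (N n))" using m by (subst ln_le_cancel_iff) auto
    \<comment> \<open>Since ln N lies between m and 4m, the constant 4000 = 4 * 1000 turns the
      assumed bound on q into the one in \<open>error_bound\<close>.\<close>
    have "1 / 4000 * ln (N n) / ln (ln (N n)) \<le> 1 / 4000 * (4 * real m) / ln (real m)"
      using lN llN m0 by (intro frac_le mult_left_mono) auto
    hence "real q \<le> real m / (1000 * ln (real m))" using q by simp
    from error_bound[OF m(1) this] M[OF m(2)]
      tester_gap[OF m2 T(1)[unfolded nm] T(2)[unfolded nm] Nm[unfolded nm], of "nat \<lceil>3 * log 2 (real m)\<rceil>"] m(1)
    show False by linarith
  qed
  have ev: "\<forall>\<^sub>F n in sequentially. 4 dvd n \<longrightarrow>
    (\<forall>A q. unate_tester n {f. 1 / 64 * N n \<le> real (card (sat n f)) \<and> real (card (sat n f)) \<le> 2 * N n} (1 / 8192) A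
        \<and> calls_le n A q \<longrightarrow> 1 / 4000 * ln (N n) / ln (ln (N n)) ^ 1 \<le> real q)"
    unfolding eventually_sequentially using main by blast
  show ?thesis
    by (rule exI[of _ "1 / 8192"], rule conjI, simp, rule exI[of _ "1 / 64"], rule conjI, simp,
        rule exI[of _ 2], rule conjI, simp, rule exI[of _ "1 / 4000"], rule conjI, simp, rule exI[of _ 1])
      (rule ev)
qed

end
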